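(* Let $W$ be a finite Coxeter group, $c$ a standard Coxeter element, and $\vec\pi\in\mathsf{MC}(W,c)$. Then the set $\{u\in W_c^+: u\text{ and }\vec\pi\text{ are concordant}\}$ is a nonempty interval in the left weak order; that is, there exist $\omega_\downarrow(\vec\pi),\omega^\uparrow(\vec\pi)\in W$ such that this set equals $[\omega_\downarrow(\vec\pi),\omega^\uparrow(\vec\pi)]_L\neq\emptyset$.
   Context: $W$ is a finite Coxeter group of rank $r$ with simple reflections $S$ and reflections $T$; $\ell_S,\ell_T$ are lengths with respect to $S,T$. Bruhat order $\leq_{\mathrm B}$: covers $u\lessdot_{\mathrm B}v$ iff $v=ut$, $t\in T$, $\ell_S(v)=\ell_S(u)+1$. Absolute order: $u\leq_T v$ iff $\ell_T(u)+\ell_T(u^{-1}v)=\ell_T(v)$. A standard Coxeter element $c$ is a product of all elements of $S$ each once in some order. $W_c^+=\{u\in W:\ell_S(uc)=\ell_S(u)+r\}$. $\mathsf{MC}(W,c)$ is the set of maximal chains $\vec\pi=\{e=\pi_0\lessdot_T\pi_1\lessdot_T\cdots\lessdot_T\pi_r=c\}$ of the interval $[e,c]_T$. $u\in W_c^+$ and $\vec\pi$ are concordant if $u\pi_0\leq_{\mathrm B}u\pi_1\leq_{\mathrm B}\cdots\leq_{\mathrm B}u\pi_r$. Left weak order: $u\leq_L v$ iff some reduced $S$-word for $v$ has a reduced $S$-word for $u$ as a suffix; $[x,y]_L$ denotes an interval in it. *)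

theory Defs
  imports "HOL-Algebra.Algebra" "HOL-Library.Sublist"
begin

definition word_prod :: "('a, 'b) monoid_scheme \<Rightarrow> 'a list \<Rightarrow> 'a" where
  "word_prod G xs = foldr (\<otimes>\<^bsub>G\<^esub>) xs \<one>\<^bsub>G\<^esub>"

text \<open>
  One application of a Coxeter relation \<open>(st)\<^sup>m = 1\<close> to a word over \<open>S\<close>, where \<open>m\<close> is the order of
  \<open>st\<close> in \<open>G\<close>. The case \<open>s = t\<close> gives \<open>s\<^sup>2 = 1\<close>, so no letters for inverses are needed. If \<open>st\<close> has
  infinite order then \<open>ord\<close> is \<open>0\<close> and the relation is trivial.
\<close>

inductive coxeter_step :: "('a, 'b) monoid_scheme \<Rightarrow> 'a set \<Rightarrow> 'a list \<Rightarrow> 'a list \<Rightarrow> bool"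
  for G (structure) and S where
  "\<lbrakk>xs \<in> lists S; ys \<in> lists S; s \<in> S; t \<in> S\<rbrakk> \<Longrightarrow>
     coxeter_step G S (xs @ concat (replicate (group.ord G (s \<otimes> t)) [s, t]) @ ys) (xs @ ys)"

text \<open>
  The last assumption says that \<open>G\<close> is presented by the generators \<open>S\<close> and the Coxeter relations:
  two words have the same value iff they are identified by the congruence the relations generate.
\<close>

locale coxeter_system = group G for G (structure) +
  fixes S
  assumes simple_closed: "S \<subseteq> carrier G"
    and simple_ord: "s \<in> S \<Longrightarrow> ord s = 2"
    and simple_generate: "generate G S = carrier G"
    and presentation: "\<lbrakk>xs \<in> lists S; ys \<in> lists S\<rbrakk> \<Longrightarrow>
      word_prod G xs = word_prod G ys \<longleftrightarrow> equivclp (coxeter_step G S) xs ys"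

definition reflections :: "('a, 'b) monoid_scheme \<Rightarrow> 'a set \<Rightarrow> 'a set" where
  "reflections G S = {w \<otimes>\<^bsub>G\<^esub> s \<otimes>\<^bsub>G\<^esub> inv\<^bsub>G\<^esub> w | w s. w \<in> carrier G \<and> s \<in> S}"

definition word_length :: "('a, 'b) monoid_scheme \<Rightarrow> 'a set \<Rightarrow> 'a \<Rightarrow> nat" where
  "word_length G A w = (LEAST n. \<exists>xs \<in> lists A. length xs = n \<and> word_prod G xs = w)"

definition reduced_word :: "('a, 'b) monoid_scheme \<Rightarrow> 'a set \<Rightarrow> 'a list \<Rightarrow> 'a \<Rightarrow> bool" where
  "reduced_word G S xs w \<longleftrightarrow>
     xs \<in> lists S \<and> word_prod G xs = w \<and> length xs = word_length G S w"

definition bruhat_cover :: "('a, 'b) monoid_scheme \<Rightarrow> 'a set \<Rightarrow> 'a \<Rightarrow> 'a \<Rightarrow> bool" where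
  "bruhat_cover G S u v \<longleftrightarrow> u \<in> carrier G \<and> (\<exists>t \<in> reflections G S. v = u \<otimes>\<^bsub>G\<^esub> t) \<and>
     word_length G S v = word_length G S u + 1"

definition bruhat_le :: "('a, 'b) monoid_scheme \<Rightarrow> 'a set \<Rightarrow> 'a \<Rightarrow> 'a \<Rightarrow> bool" where
  "bruhat_le G S u v \<longleftrightarrow> u \<in> carrier G \<and> v \<in> carrier G \<and> (bruhat_cover G S)\<^sup>*\<^sup>* u v"

definition absolute_le :: "('a, 'b) monoid_scheme \<Rightarrow> 'a set \<Rightarrow> 'a \<Rightarrow> 'a \<Rightarrow> bool" where
  "absolute_le G S u v \<longleftrightarrow> u \<in> carrier G \<and> v \<in> carrier G \<and>
     word_length G (reflections G S) u + word_length G (reflections G S) (inv\<^bsub>G\<^esub> u \<otimes>\<^bsub>G\<^esub> v)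
       = word_length G (reflections G S) v"

definition absolute_cover :: "('a, 'b) monoid_scheme \<Rightarrow> 'a set \<Rightarrow> 'a \<Rightarrow> 'a \<Rightarrow> bool" where
  "absolute_cover G S u v \<longleftrightarrow> absolute_le G S u v \<and> u \<noteq> v \<and>
     (\<forall>w. absolute_le G S u w \<and> absolute_le G S w v \<longrightarrow> w = u \<or> w = v)"

definition left_weak_le :: "('a, 'b) monoid_scheme \<Rightarrow> 'a set \<Rightarrow> 'a \<Rightarrow> 'a \<Rightarrow> bool" where
  "left_weak_le G S u v \<longleftrightarrow>
     (\<exists>xs ys. reduced_word G S xs u \<and> reduced_word G S ys v \<and> suffix xs ys)"

definition left_weak_interval :: "('a, 'b) monoid_scheme \<Rightarrow> 'a set \<Rightarrow> 'a \<Rightarrow> 'a \<Rightarrow> 'a set" where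
  "left_weak_interval G S x y = {w \<in> carrier G. left_weak_le G S x w \<and> left_weak_le G S w y}"

definition standard_coxeter_element :: "('a, 'b) monoid_scheme \<Rightarrow> 'a set \<Rightarrow> 'a \<Rightarrow> bool" where
  "standard_coxeter_element G S c \<longleftrightarrow> (\<exists>xs. distinct xs \<and> set xs = S \<and> word_prod G xs = c)"

definition W_plus :: "('a, 'b) monoid_scheme \<Rightarrow> 'a set \<Rightarrow> 'a \<Rightarrow> 'a set" where
  "W_plus G S c =
     {u \<in> carrier G. word_length G S (u \<otimes>\<^bsub>G\<^esub> c) = word_length G S u + card S}"

text \<open>A maximal chain is represented by the list \<open>[\<pi>\<^sub>0, \<dots>, \<pi>\<^sub>r]\<close> of its elements, with \<open>r = card S\<close>.\<close>

definition max_chains :: "('a, 'b) monoid_scheme \<Rightarrow> 'a set \<Rightarrow> 'a \<Rightarrow> 'a list set" where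
  "max_chains G S c =
     {\<pi>. length \<pi> = card S + 1 \<and> \<pi> ! 0 = \<one>\<^bsub>G\<^esub> \<and> \<pi> ! card S = c \<and>
         (\<forall>i < card S. absolute_cover G S (\<pi> ! i) (\<pi> ! Suc i))}"

definition concordant :: "('a, 'b) monoid_scheme \<Rightarrow> 'a set \<Rightarrow> 'a \<Rightarrow> 'a list \<Rightarrow> bool" where
  "concordant G S u \<pi> \<longleftrightarrow>
     (\<forall>i < card S. bruhat_le G S (u \<otimes>\<^bsub>G\<^esub> \<pi> ! i) (u \<otimes>\<^bsub>G\<^esub> \<pi> ! Suc i))"

end

theory Submission
  imports Defs Complex_Main "HOL-Library.Function_Algebras"
begin

text \<open>
  Write \<open>c = t\<^sub>1 \<cdots> t\<^sub>r\<close> for the reflection factorisation attached to the chain. Membership in \<open>W\<^sub>c\<^sup>+\<close>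
  together with concordance says that \<open>u, u t\<^sub>1, u t\<^sub>1 t\<^sub>2, \<dots>, u c\<close> is a saturated Bruhat chain, and the set
  of these \<open>u\<close> is convex in the left weak order because each step is a sign condition on the image
  of a root under \<open>u\<close>. So it is enough to find a greatest and a least element.

  For the greatest element, more generally for \<open>c\<close> a Coxeter element of the parabolic subgroup of \<open>J\<close>,
  let \<open>s\<close> be the initial letter of \<open>c\<close>. If \<open>s\<close> is not among the \<open>t\<^sub>i\<close>, then \<open>u \<mapsto> u s\<close>
  identifies the set with the one for \<open>s c s\<close> and the conjugated factorisation. If \<open>s = t\<^sub>k\<close>, moving \<open>s\<close>
  to the front gives a factorisation of \<open>s c\<close>, a Coxeter element of the parabolic subgroup of
  \<open>I = J - {s}\<close>; a greatest element \<open>b\<close> there yields the greatest element \<open>w\<^sub>J w\<^sub>I b s\<close>, where \<open>w\<^sub>J\<close> and \<open>w\<^sub>I\<close>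
  are the longest elements. The second case is always reached: otherwise a positive root would stay
  positive under all powers of \<open>c\<close>, and the sum over its orbit would be a nonzero fixed vector of \<open>c\<close>.

  The least element is obtained from the greatest element for \<open>c\<^sup>-\<^sup>1\<close> and the reversed factorisation
  through the order-reversing map \<open>u \<mapsto> w\<^sub>0 u c\<close>.
\<close>

section \<open>Words in a group\<close>

lemma word_prod_Nil [simp]: "word_prod G [] = \<one>\<^bsub>G\<^esub>"
  and word_prod_Cons [simp]: "word_prod G (x # xs) = x \<otimes>\<^bsub>G\<^esub> word_prod G xs"
  by (simp_all add: word_prod_def)

context group
begin

lemma word_prod_closed [simp, intro]: "set xs \<subseteq> carrier G \<Longrightarrow> word_prod G xs \<in> carrier G"
  by (induction xs) auto

lemma word_prod_append:
  "set xs \<subseteq> carrier G \<Longrightarrow> set ys \<subseteq> carrier G \<Longrightarrow>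
    word_prod G (xs @ ys) = word_prod G xs \<otimes> word_prod G ys"
  by (induction xs) (auto simp: m_assoc)

lemma word_prod_rev:
  assumes "set xs \<subseteq> carrier G" and "\<And>x. x \<in> set xs \<Longrightarrow> inv x = x"
  shows "word_prod G (rev xs) = inv (word_prod G xs)"
  using assms by (induction xs) (auto simp: word_prod_append inv_mult_group)

lemma word_prod_conj:
  assumes "set xs \<subseteq> carrier G" "g \<in> carrier G"
  shows "word_prod G (map (\<lambda>x. g \<otimes> x \<otimes> inv g) xs) = g \<otimes> word_prod G xs \<otimes> inv g"
  using assms
proof (induction xs)
  case (Cons x xs)
  then have "word_prod G (map (\<lambda>x. g \<otimes> x \<otimes> inv g) (x # xs)) =
      (g \<otimes> x \<otimes> inv g) \<otimes> (g \<otimes> word_prod G xs \<otimes> inv g)" by simp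
  also have "\<dots> = g \<otimes> x \<otimes> (inv g \<otimes> g) \<otimes> word_prod G xs \<otimes> inv g"
    using Cons.prems by (simp add: m_assoc inv_solve_left')
  finally show ?case using Cons.prems by (simp add: m_assoc)
qed simp

lemma word_length_le:
  assumes "xs \<in> lists A" "word_prod G xs = w"
  shows "word_length G A w \<le> length xs"
  unfolding word_length_def using assms by (intro Least_le) auto

lemma word_length_attained:
  assumes "xs \<in> lists A" "word_prod G xs = w"
  obtains ys where "ys \<in> lists A" "word_prod G ys = w" "length ys = word_length G A w"
proof -
  have "\<exists>n. \<exists>xs\<in>lists A. length xs = n \<and> word_prod G xs = w" using assms by blast
  from LeastI_ex[OF this] have "\<exists>ys\<in>lists A. length ys = word_length G A w \<and> word_prod G ys = w"
    unfolding word_length_def .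
  with that show thesis by blast
qed

lemma word_length_one [simp]: "word_length G A \<one> = 0"
  using word_length_le[of "[]" A \<one>] by simp

end

section \<open>Lengths in a finite Coxeter group\<close>

locale finite_coxeter_system = coxeter_system G S for G (structure) and S +
  assumes finite_carrier: "finite (carrier G)"
begin

abbreviation len :: "'a \<Rightarrow> nat" where "len \<equiv> word_length G S"
abbreviation wp :: "'a list \<Rightarrow> 'a" where "wp \<equiv> word_prod G"

lemma S_closed [simp, intro]: "s \<in> S \<Longrightarrow> s \<in> carrier G"
  using simple_closed by auto

lemma finite_S: "finite S"
  using simple_closed finite_carrier finite_subset by auto

lemma S_square [simp]: "s \<in> S \<Longrightarrow> s \<otimes> s = \<one>"
  using pow_ord_eq_1[of s] simple_ord[of s] by (simp add: numeral_2_eq_2)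

lemma S_inv [simp]: "s \<in> S \<Longrightarrow> inv s = s"
  by (simp add: inv_equality)

lemma S_cancel [simp]: "s \<in> S \<Longrightarrow> w \<in> carrier G \<Longrightarrow> w \<otimes> s \<otimes> s = w"
  by (simp add: m_assoc)

lemma S_cancel' [simp]: "s \<in> S \<Longrightarrow> w \<in> carrier G \<Longrightarrow> s \<otimes> (s \<otimes> w) = w"
  by (simp add: m_assoc[symmetric])

lemma lists_S_carrier [simp]: "xs \<in> lists S \<Longrightarrow> set xs \<subseteq> carrier G"
  using simple_closed by auto

lemma lists_S_closed [simp, intro]: "xs \<in> lists S \<Longrightarrow> wp xs \<in> carrier G"
  by (simp add: word_prod_closed)

lemma word_exists:
  assumes "w \<in> carrier G" obtains xs where "xs \<in> lists S" "wp xs = w"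
proof -
  have "w \<in> generate G S" using assms simple_generate by simp
  then have "\<exists>xs \<in> lists S. wp xs = w"
  proof (induction rule: generate.induct)
    case one
    then show ?case by (intro bexI[of _ "[]"]) auto
  next
    case (incl h)
    then show ?case by (intro bexI[of _ "[h]"]) auto
  next
    case (inv h)
    then show ?case by (intro bexI[of _ "[h]"]) auto
  next
    case (eng h1 h2)
    then obtain xs ys where "xs \<in> lists S" "wp xs = h1" "ys \<in> lists S" "wp ys = h2" by auto
    then show ?case
      by (intro bexI[of _ "xs @ ys"]) (auto simp: word_prod_append)
  qed
  with that show thesis by blast
qed

lemma reduced_exists:
  assumes "w \<in> carrier G"
  obtains xs where "xs \<in> lists S" "wp xs = w" "length xs = len w"
  using word_exists[OF assms] word_length_attained by metis

lemma len_mult_le: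
  assumes "u \<in> carrier G" "v \<in> carrier G"
  shows "len (u \<otimes> v) \<le> len u + len v"
proof -
  obtain xs where xs: "xs \<in> lists S" "wp xs = u" "length xs = len u"
    using reduced_exists[OF assms(1)] .
  obtain ys where ys: "ys \<in> lists S" "wp ys = v" "length ys = len v"
    using reduced_exists[OF assms(2)] .
  have "xs @ ys \<in> lists S" "wp (xs @ ys) = u \<otimes> v"
    using xs ys by (auto simp: word_prod_append)
  from word_length_le[OF this] show ?thesis using xs ys by simp
qed

lemma len_inv_le: "w \<in> carrier G \<Longrightarrow> len (inv w) \<le> len w"
proof -
  assume "w \<in> carrier G"
  then obtain xs where xs: "xs \<in> lists S" "wp xs = w" "length xs = len w"
    using reduced_exists by blast
  then have "wp (rev xs) = inv w" by (subst word_prod_rev) auto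
  moreover have "rev xs \<in> lists S" using xs by auto
  ultimately show ?thesis using word_length_le xs(3) by (metis length_rev)
qed

lemma len_inv [simp]: "w \<in> carrier G \<Longrightarrow> len (inv w) = len w"
  using len_inv_le[of w] len_inv_le[of "inv w"] by simp

lemma len_zero: "w \<in> carrier G \<Longrightarrow> len w = 0 \<Longrightarrow> w = \<one>"
  by (metis length_0_conv reduced_exists word_prod_Nil)

text \<open>A relator consists of pairs \<open>[s, t]\<close>, so the parity of a word is an
  invariant of its value. This is what rules out \<open>len (w s) = len w\<close> later.\<close>

lemma parity_step: "coxeter_step G S xs ys \<Longrightarrow> even (length xs) = even (length ys)"
proof (induction rule: coxeter_step.induct)
  case (1 xs ys s t)
  have "even (length (concat (replicate n [s, t])))" for n by (induction n) auto
  then show ?case by simp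
qed

lemma parity_word:
  assumes "xs \<in> lists S" "ys \<in> lists S" "wp xs = wp ys"
  shows "even (length xs) = even (length ys)"
proof -
  have "equivclp (coxeter_step G S) xs ys" using presentation assms by blast
  then show ?thesis
    by (induction rule: equivclp_induct) (auto dest: parity_step)
qed

lemma len_simple_ne:
  assumes "w \<in> carrier G" "s \<in> S" shows "len (w \<otimes> s) \<noteq> len w"
proof
  assume eq: "len (w \<otimes> s) = len w"
  obtain xs where xs: "xs \<in> lists S" "wp xs = w" "length xs = len w"
    using reduced_exists[OF assms(1)] .
  obtain ys where ys: "ys \<in> lists S" "wp ys = w \<otimes> s" "length ys = len (w \<otimes> s)"
    using reduced_exists[of "w \<otimes> s"] assms by auto
  have "xs @ [s] \<in> lists S" "wp (xs @ [s]) = w \<otimes> s"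
    using xs assms by (auto simp: word_prod_append)
  from parity_word[OF this(1) ys(1)] this(2) xs ys eq show False by simp
qed

lemma len_simple_le1: "s \<in> S \<Longrightarrow> len s \<le> 1"
  using word_length_le[of "[s]" S s] by simp

lemma len_simple_cases:
  assumes "w \<in> carrier G" "s \<in> S"
  obtains "len (w \<otimes> s) = len w + 1" | "len w = len (w \<otimes> s) + 1"
proof -
  have "len (w \<otimes> s) \<le> len w + 1"
    using len_mult_le[of w s] len_simple_le1[of s] assms by simp
  moreover have "len w \<le> len (w \<otimes> s) + 1"
    using len_mult_le[of "w \<otimes> s" s] len_simple_le1[of s] assms by simp
  moreover note len_simple_ne[OF assms]
  ultimately have "len (w \<otimes> s) = len w + 1 \<or> len w = len (w \<otimes> s) + 1" by linarith
  then show thesis using that by blast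
qed

lemma len_descent:
  assumes "w \<in> carrier G" "s \<in> S" "\<not> len w < len (w \<otimes> s)"
  shows "len w = len (w \<otimes> s) + 1"
  by (rule len_simple_cases[OF assms(1,2)]) (use assms(3) in auto)

lemma len_ascent:
  assumes "w \<in> carrier G" "s \<in> S" "\<not> len (w \<otimes> s) < len w"
  shows "len (w \<otimes> s) = len w + 1"
  by (rule len_simple_cases[OF assms(1,2)]) (use assms(3) in auto)

lemma descent_exists:
  assumes "w \<in> carrier G" "w \<noteq> \<one>"
  obtains s where "s \<in> S" "len (w \<otimes> s) < len w"
proof -
  obtain xs where xs: "xs \<in> lists S" "wp xs = w" "length xs = len w"
    using reduced_exists[OF assms(1)] .
  have "xs \<noteq> []" using xs(2) assms(2) by auto
  then obtain ys s where ys: "xs = ys @ [s]" by (meson rev_exhaust)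
  have s: "s \<in> S" "ys \<in> lists S" using xs ys by auto
  have "w = wp ys \<otimes> s"
    using xs(2) s unfolding ys by (subst (asm) word_prod_append) auto
  then have "w \<otimes> s = wp ys" using s by simp
  then have "len (w \<otimes> s) \<le> length ys" using word_length_le[OF s(2)] by simp
  then show thesis using that s(1) xs(3) ys by simp
qed

section \<open>The geometric representation\<close>

text \<open>\<open>coef s v = 2 B(\<alpha>\<^sub>s, v)\<close> for the usual bilinear form; for \<open>s = t\<close> the order is \<open>1\<close> and \<open>- cos \<pi> = 1\<close>, so
  the diagonal needs no separate case.\<close>

definition coef :: "'a \<Rightarrow> ('a \<Rightarrow> real) \<Rightarrow> real" where
  "coef s v = 2 * (\<Sum>t\<in>S. v t * - cos (pi / real (ord (s \<otimes> t))))"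

text \<open>Vectors are coordinate functions in the basis of simple roots. Coordinates outside
  \<open>S\<close> are neither read by \<open>coef\<close> nor changed by a simple reflection, so
  they are harmless.\<close>

definition srefl :: "'a \<Rightarrow> ('a \<Rightarrow> real) \<Rightarrow> 'a \<Rightarrow> real" where
  "srefl s v = v(s := v s - coef s v)"

definition sroot :: "'a \<Rightarrow> 'a \<Rightarrow> real" where
  "sroot s x = (if x = s then 1 else 0)"

lemma ord_pos: "x \<in> carrier G \<Longrightarrow> ord x > 0"
  using ord_ge_1[OF finite_carrier, of x] by simp

lemma ord_comm: "s \<in> S \<Longrightarrow> t \<in> S \<Longrightarrow> ord (s \<otimes> t) = ord (t \<otimes> s)"
  using ord_inv[of "s \<otimes> t"] by (simp add: inv_mult_group)

lemma ord_ge2: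
  assumes "s \<in> S" "t \<in> S" "s \<noteq> t" shows "ord (s \<otimes> t) \<ge> 2"
proof -
  have "ord (s \<otimes> t) \<noteq> 1"
  proof
    assume "ord (s \<otimes> t) = 1"
    then have "s \<otimes> t = \<one>" using pow_ord_eq_1[of "s \<otimes> t"] assms by simp
    then have "s \<otimes> t \<otimes> t = t" using assms by (simp del: S_cancel)
    then show False using assms by simp
  qed
  moreover have "ord (s \<otimes> t) > 0" using ord_pos assms by simp
  ultimately show ?thesis by simp
qed

lemma coef_lin: "coef s (\<lambda>x. a * v x + b * w x) = a * coef s v + b * coef s w"
  by (simp add: coef_def sum.distrib sum_distrib_left algebra_simps sum_subtractf sum_negf)

lemma srefl_lin: "srefl s (\<lambda>x. a * v x + b * w x) = (\<lambda>x. a * srefl s v x + b * srefl s w x)"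
  by (auto simp: srefl_def coef_lin algebra_simps)

lemma coef_sroot: "t \<in> S \<Longrightarrow> coef s (sroot t) = - 2 * cos (pi / real (ord (s \<otimes> t)))"
proof -
  assume t: "t \<in> S"
  have "(\<Sum>x\<in>S. sroot t x * - cos (pi / real (ord (s \<otimes> x)))) =
      (\<Sum>x\<in>S. if x = t then - cos (pi / real (ord (s \<otimes> t))) else 0)"
    by (rule sum.cong) (auto simp: sroot_def)
  also have "\<dots> = - cos (pi / real (ord (s \<otimes> t)))" using t finite_S by simp
  finally show ?thesis by (simp add: coef_def)
qed

lemma coef_sroot_self [simp]: "s \<in> S \<Longrightarrow> coef s (sroot s) = 2"
  by (simp add: coef_sroot)

lemma srefl_eq: "srefl s v = (\<lambda>x. 1 * v x + (- coef s v) * sroot s x)"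
  by (auto simp: srefl_def sroot_def)

lemma coef_srefl: "s \<in> S \<Longrightarrow> coef s (srefl s v) = - coef s v"
  by (subst srefl_eq) (simp only: coef_lin, simp)

lemma srefl_srefl [simp]: "s \<in> S \<Longrightarrow> srefl s (srefl s v) = v"
  using coef_srefl[of s v] by (auto simp: srefl_def)

lemma srefl_sroot [simp]: "s \<in> S \<Longrightarrow> srefl s (sroot s) = (\<lambda>x. - sroot s x)"
  by (auto simp: srefl_def sroot_def[abs_def] coef_sroot_self[unfolded sroot_def[abs_def]])

text \<open>On the plane of \<open>s\<close> and \<open>t\<close> two consecutive reflections realise the recursion
  \<open>z (n + 1) = 2 cos \<theta> z n - z (n - 1)\<close>, solved by Chebyshev quotients of sines.\<close>

definition cheb :: "real \<Rightarrow> real \<Rightarrow> real \<Rightarrow> real \<Rightarrow> real" where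
  "cheb \<theta> x y n = (sin ((n + 1) * \<theta>) * x - sin (n * \<theta>) * y) / sin \<theta>"

lemma cheb_rec: "cheb \<theta> x y (n + 1) = 2 * cos \<theta> * cheb \<theta> x y n - cheb \<theta> x y (n - 1)"
proof -
  have *: "sin ((m + 1) * \<theta>) = 2 * cos \<theta> * sin (m * \<theta>) - sin ((m - 1) * \<theta>)" for m :: real
    by (simp add: distrib_right left_diff_distrib sin_add sin_diff)
  have e: "sin ((n + 1 + 1) * \<theta>) = 2 * cos \<theta> * sin ((n + 1) * \<theta>) - sin (n * \<theta>)"
    using *[of "n + 1"] by simp
  have "sin ((n + 1 + 1) * \<theta>) * x - sin ((n + 1) * \<theta>) * y =
      2 * cos \<theta> * (sin ((n + 1) * \<theta>) * x - sin (n * \<theta>) * y) -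
      (sin ((n - 1 + 1) * \<theta>) * x - sin ((n - 1) * \<theta>) * y)"
    unfolding e *[of n] by (simp add: left_diff_distrib right_diff_distrib)
  then show ?thesis unfolding cheb_def by (simp only: diff_divide_distrib[symmetric] times_divide_eq_right)
qed

lemma sin_angle_pos:
  assumes "s \<in> S" "t \<in> S" "s \<noteq> t" shows "sin (pi / real (ord (s \<otimes> t))) > 0"
proof (rule sin_gt_zero)
  have o: "real (ord (s \<otimes> t)) \<ge> 2" using ord_ge2[OF assms] by simp
  then show "0 < pi / real (ord (s \<otimes> t))" by simp
  show "pi / real (ord (s \<otimes> t)) < pi" using o pi_gt_zero by (simp add: field_simps)
qed

text \<open>In use \<open>v\<close> is orthogonal to both roots, so the two reflections act on the
  coefficients \<open>a\<close> and \<open>b\<close> alone.\<close>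

definition plane :: "'a \<Rightarrow> 'a \<Rightarrow> ('a \<Rightarrow> real) \<Rightarrow> real \<Rightarrow> real \<Rightarrow> 'a \<Rightarrow> real" where
  "plane s t v a b = (\<lambda>x. v x + a * sroot s x + b * sroot t x)"

lemma plane_commute: "plane s t v a b = plane t s v b a"
  by (auto simp: plane_def)

lemma coef_plane: "coef r (plane s t v a b) = coef r v + a * coef r (sroot s) + b * coef r (sroot t)"
proof -
  have "plane s t v a b = (\<lambda>x. 1 * (\<lambda>x. 1 * v x + a * sroot s x) x + b * sroot t x)"
    by (simp add: plane_def)
  then show ?thesis by (simp only: coef_lin, simp)
qed

lemma srefl_plane:
  assumes "s \<in> S" "t \<in> S" "s \<noteq> t" "coef s v = 0"
  shows "srefl s (plane s t v a b) = plane s t v (2 * cos (pi / real (ord (s \<otimes> t))) * b - a) b"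
proof -
  have "coef s (plane s t v a b) = 2 * a - 2 * cos (pi / real (ord (s \<otimes> t))) * b"
    using assms by (simp add: coef_plane coef_sroot algebra_simps)
  then show ?thesis using assms(3)
    by (auto simp: srefl_def plane_def sroot_def fun_eq_iff)
qed

lemma srefl_plane':
  assumes "s \<in> S" "t \<in> S" "s \<noteq> t" "coef t v = 0"
  shows "srefl t (plane s t v a b) = plane s t v a (2 * cos (pi / real (ord (s \<otimes> t))) * a - b)"
  using srefl_plane[of t s v b a] assms by (simp add: plane_commute[of s t] ord_comm)


text \<open>The two coefficients are always consecutive values of \<open>cheb\<close>; each
  reflection replaces the older one by the next value.\<close>

lemma plane_alternate:
  assumes st: "s \<in> S" "t \<in> S" "s \<noteq> t" and v: "coef s v = 0" "coef t v = 0"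
    and \<theta>: "\<theta> = pi / real (ord (s \<otimes> t))"
  shows "foldr srefl (concat (replicate n [s, t])) (plane s t v x y) =
    plane s t v (cheb \<theta> x y (2 * real n)) (cheb \<theta> x y (2 * real n - 1))"
proof (induction n)
  case 0
  have "sin \<theta> \<noteq> 0" using sin_angle_pos[OF st] \<theta> by simp
  then show ?case by (simp add: cheb_def)
next
  case (Suc n)
  have "foldr srefl (concat (replicate (Suc n) [s, t])) (plane s t v x y) =
      srefl s (srefl t (plane s t v (cheb \<theta> x y (2 * real n)) (cheb \<theta> x y (2 * real n - 1))))"
    using Suc by simp
  also have "\<dots> = srefl s (plane s t v (cheb \<theta> x y (2 * real n)) (cheb \<theta> x y (2 * real n + 1)))"
    using srefl_plane'[OF st v(2)] cheb_rec[of \<theta> x y "2 * real n"] by (simp add: \<theta>)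
  also have "\<dots> = plane s t v (cheb \<theta> x y (2 * real n + 2)) (cheb \<theta> x y (2 * real n + 1))"
    using srefl_plane[OF st v(1)] cheb_rec[of \<theta> x y "2 * real n + 1"] by (simp add: \<theta> add.commute)
  finally show ?case by (simp add: algebra_simps)
qed

text \<open>After removing the part orthogonal to both roots, the product of the two reflections is
  a rotation by \<open>2 * \<theta>\<close> of their plane, and \<open>m\<close> such rotations make
  a full turn.\<close>

lemma srefl_braid:
  assumes st: "s \<in> S" "t \<in> S" "s \<noteq> t"
  shows "foldr srefl (concat (replicate (ord (s \<otimes> t)) [s, t])) v = v"
proof -
  define m where "m = ord (s \<otimes> t)"
  define \<theta> where "\<theta> = pi / real m"
  have m: "m \<ge> 2" using ord_ge2[OF st] m_def by simp
  have sp: "sin \<theta> > 0" using sin_angle_pos[OF st] by (simp add: \<theta>_def m_def)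
  \<comment> \<open>\<open>d\<close> is half the determinant of the Gram system for \<open>s\<close>
    and \<open>t\<close>; \<open>p\<close> and \<open>q\<close> are its solution by Cramer's rule,
    chosen so that \<open>u\<close> becomes orthogonal to both roots.\<close>
  define d where "d = 2 * (1 - (cos \<theta>)\<^sup>2)"
  have d0: "d \<noteq> 0" using sp by (simp add: d_def sin_squared_eq[symmetric])
  define p where "p = (coef s v + cos \<theta> * coef t v) / d"
  define q where "q = (coef t v + cos \<theta> * coef s v) / d"
  define u where "u = plane s t v (- p) (- q)"
  have cs: "coef s u = coef s v - 2 * p + 2 * cos \<theta> * q"
    using st by (simp add: u_def coef_plane coef_sroot \<theta>_def m_def)
  have ct: "coef t u = coef t v - 2 * q + 2 * cos \<theta> * p"
    using st by (simp add: u_def coef_plane coef_sroot \<theta>_def m_def ord_comm)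
  have "d * coef s u = 0" "d * coef t u = 0"
    unfolding cs ct p_def q_def using d0
    by (simp_all add: field_simps, simp_all add: d_def algebra_simps power2_eq_square)
  then have u0: "coef s u = 0" "coef t u = 0" using d0 by auto
  have v: "v = plane s t u p q" by (simp add: u_def plane_def)
  have "2 * real m * \<theta> = 2 * pi" using m by (simp add: \<theta>_def)
  then have sc: "sin (2 * real m * \<theta>) = 0" "cos (2 * real m * \<theta>) = 1" by (simp_all only: sin_two_pi cos_two_pi)
  then have e: "sin ((2 * real m + 1) * \<theta>) = sin \<theta>" "sin (2 * real m * \<theta>) = 0"
    "sin ((2 * real m - 1) * \<theta>) = - sin \<theta>"
    by (simp_all only: distrib_right left_diff_distrib sin_diff sin_add, simp_all)
  have "cheb \<theta> p q (2 * real m) = p" "cheb \<theta> p q (2 * real m - 1) = q"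
    using sp by (simp_all add: cheb_def e)
  then show ?thesis
    using plane_alternate[OF st u0, of \<theta> m p q] v by (simp add: \<theta>_def m_def)
qed

lemma srefl_step: "coxeter_step G S xs ys \<Longrightarrow> foldr srefl xs v = foldr srefl ys v"
proof (induction rule: coxeter_step.induct)
  case (1 xs ys s t)
  show ?case
  proof (cases "s = t")
    case True
    then have "ord (s \<otimes> t) = 1" using 1 by simp
    then show ?thesis using True 1 by simp
  next
    case False
    then show ?thesis using srefl_braid[of s t] 1 by simp
  qed
qed

lemma srefl_word:
  assumes "xs \<in> lists S" "ys \<in> lists S" "wp xs = wp ys"
  shows "foldr srefl xs v = foldr srefl ys v"
proof -
  have "equivclp (coxeter_step G S) xs ys" using presentation assms by blast
  then show ?thesis
    by (induction rule: equivclp_induct) (auto dest: srefl_step[where v = v])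
qed

text \<open>By \<open>srefl_word\<close> the choice of the word is immaterial for elements of the
  group.\<close>

definition act :: "'a \<Rightarrow> ('a \<Rightarrow> real) \<Rightarrow> 'a \<Rightarrow> real" where
  "act w = foldr srefl (SOME xs. xs \<in> lists S \<and> wp xs = w)"

lemma act_word: "xs \<in> lists S \<Longrightarrow> act (wp xs) v = foldr srefl xs v"
  unfolding act_def by (rule someI2[of _ xs]) (auto intro: srefl_word)

lemma act_one [simp]: "act \<one> v = v"
  using act_word[of "[]"] by simp

lemma act_simple [simp]: "s \<in> S \<Longrightarrow> act s v = srefl s v"
  using act_word[of "[s]"] by simp

lemma act_mult [simp]:
  assumes "u \<in> carrier G" "w \<in> carrier G" shows "act (u \<otimes> w) v = act u (act w v)"
proof -
  obtain xs where xs: "xs \<in> lists S" "wp xs = u" using word_exists[OF assms(1)] .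
  obtain ys where ys: "ys \<in> lists S" "wp ys = w" using word_exists[OF assms(2)] .
  have "wp (xs @ ys) = u \<otimes> w" using xs ys by (simp add: word_prod_append)
  moreover have "xs @ ys \<in> lists S" using xs ys by auto
  ultimately show ?thesis using act_word xs ys by (metis foldr_append comp_apply)
qed

lemma act_inv1 [simp]: "w \<in> carrier G \<Longrightarrow> act w (act (inv w) v) = v"
  by (simp flip: act_mult)

lemma act_inv2 [simp]: "w \<in> carrier G \<Longrightarrow> act (inv w) (act w v) = v"
  by (simp flip: act_mult)

lemma foldr_srefl_lin:
  "foldr srefl xs (\<lambda>x. a * v x + b * w x) = (\<lambda>x. a * foldr srefl xs v x + b * foldr srefl xs w x)"
  by (induction xs) (simp_all add: srefl_lin)

lemma act_lin: "act g (\<lambda>x. a * v x + b * w x) = (\<lambda>x. a * act g v x + b * act g w x)"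
  by (simp add: act_def foldr_srefl_lin)

lemma act_scale: "act g (\<lambda>x. a * v x) = (\<lambda>x. a * act g v x)"
  using act_lin[of g a v 0 v] by simp

lemma act_minus: "act g (\<lambda>x. - v x) = (\<lambda>x. - act g v x)"
  using act_scale[of g "-1" v] by simp

lemma act_zero: "act g (\<lambda>x. 0) = (\<lambda>x. 0)"
  using act_scale[of g 0 "\<lambda>x. 0"] by simp

lemma act_sum: "act g (\<lambda>x. \<Sum>i\<in>A. a i * v i x) = (\<lambda>x. \<Sum>i\<in>A. a i * act g (v i) x)"
proof (induction A rule: infinite_finite_induct)
  case (insert i A)
  then show ?case using act_lin[of g "a i" "v i" 1 "\<lambda>x. \<Sum>i\<in>A. a i * v i x"] by simp
qed (simp_all add: act_zero)

lemma act_eq_zero: "w \<in> carrier G \<Longrightarrow> act w v = (\<lambda>x. 0) \<Longrightarrow> v = (\<lambda>x. 0)"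
  using act_inv2[of w v] by (simp add: act_zero)

section \<open>Roots are positive or negative\<close>

text \<open>Letters are added on the left, so the last letter is always \<open>t\<close> and shorter
  words are suffixes of longer ones.\<close>

fun alternating :: "nat \<Rightarrow> 'a \<Rightarrow> 'a \<Rightarrow> 'a list" where
  "alternating 0 s t = []"
| "alternating (Suc n) s t = (if even n then t else s) # alternating n s t"

lemma alternating_snoc: "alternating (Suc n) t s = alternating n s t @ [s]"
  by (induction n) auto

lemma alternating_suffix:
  "\<exists>q. alternating (a + b) s t = q @ alternating b s t \<and> length q = a \<and> set q \<subseteq> {s, t}"
proof (induction a)
  case (Suc a)
  then obtain q where "alternating (a + b) s t = q @ alternating b s t" "length q = a" "set q \<subseteq> {s, t}"
    by blast
  then show ?case by (intro exI[of _ "(if even (a + b) then t else s) # q"]) auto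
qed simp

lemma length_alternating [simp]: "length (alternating n s t) = n"
  by (induction n) auto

lemma set_alternating: "set (alternating n s t) \<subseteq> {s, t}"
  by (induction n) auto

lemma alternating_lists: "s \<in> S \<Longrightarrow> t \<in> S \<Longrightarrow> alternating n s t \<in> lists S"
  using set_alternating[of n s t] by auto

lemma alternating_double: "alternating (2 * n) s t = concat (replicate n [s, t])"
  by (induction n) auto

lemma word_prod_relation:
  assumes "s \<in> S" "t \<in> S"
  shows "wp (concat (replicate (ord (s \<otimes> t)) [s, t])) = \<one>"
proof -
  have "wp (concat (replicate n [s, t])) = (s \<otimes> t) [^] n" for n
  proof (induction n)
    case (Suc n)
    have "wp (concat (replicate (Suc n) [s, t])) = (s \<otimes> t) \<otimes> (s \<otimes> t) [^] n"
      using Suc assms by (simp add: m_assoc)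
    then show ?case using nat_pow_Suc2[of "s \<otimes> t" n] assms by simp
  qed simp
  then show ?thesis using assms by simp
qed

text \<open>The product has an alternating word of \<open>k + 1\<close> letters. With
  \<open>m\<close> the order of \<open>s t\<close>, the relation makes its last \<open>m + 1\<close>
  letters the inverse of a word of \<open>m - 1\<close> letters, which saves two.\<close>

lemma alternating_long:
  assumes st: "s \<in> S" "t \<in> S" "s \<noteq> t" and k: "ord (s \<otimes> t) \<le> k"
  shows "len (wp (alternating k s t) \<otimes> s) < k"
proof -
  define m where "m = ord (s \<otimes> t)"
  have m: "m \<ge> 2" using ord_ge2[OF st] m_def by simp
  have "\<exists>q. alternating ((k - m) + (m + 1)) t s = q @ alternating (m + 1) t s \<and> length q = k - m \<and> set q \<subseteq> {t, s}"
    by (rule alternating_suffix)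
  then obtain q where q: "alternating (k + 1) t s = q @ alternating (m + 1) t s" "length q = k - m" "q \<in> lists S"
    using k st by (auto simp: m_def)
  have "\<exists>p. alternating ((m - 1) + (m + 1)) t s = p @ alternating (m + 1) t s \<and> length p = m - 1 \<and> set p \<subseteq> {t, s}"
    by (rule alternating_suffix)
  moreover have "(m - 1) + (m + 1) = 2 * m" using m by simp
  ultimately obtain p where p: "alternating (2 * m) t s = p @ alternating (m + 1) t s" "length p = m - 1" "set p \<subseteq> {t, s}"
    by metis
  then have pS: "p \<in> lists S" using st by auto
  let ?e = "wp (alternating (m + 1) t s)"
  have e: "?e \<in> carrier G" using alternating_lists[OF st(2,1)] by blast
  have "wp p \<otimes> ?e = \<one>"
  proof -
    have "wp p \<otimes> ?e = wp (p @ alternating (m + 1) t s)"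
      using pS alternating_lists[OF st(2,1), of "m + 1"] by (simp add: word_prod_append del: alternating.simps)
    also have "\<dots> = \<one>"
      unfolding p(1)[symmetric] alternating_double
      using word_prod_relation[OF st(2,1)] by (simp add: m_def ord_comm[OF st(1,2)])
    finally show ?thesis .
  qed
  then have "?e = inv (wp p)" using pS e by (metis inv_equality inv_inv lists_S_closed)
  then have "len ?e \<le> m - 1" using word_length_le[of p S "wp p"] p(2) pS by simp
  moreover have "wp (alternating k s t) \<otimes> s = wp q \<otimes> ?e"
  proof -
    have "wp (alternating k s t) \<otimes> s = wp (alternating k s t @ [s])"
      using st alternating_lists[OF st(1,2), of k] by (simp add: word_prod_append)
    also have "alternating k s t @ [s] = q @ alternating (m + 1) t s"
      using q(1) alternating_snoc[of k t s] by simp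
    finally show ?thesis using q(3) alternating_lists[OF st(2,1), of "m + 1"]
      by (simp add: word_prod_append del: alternating.simps)
  qed
  moreover have "len (wp q) \<le> k - m" using word_length_le[of q S "wp q"] q by simp
  moreover have "len (wp q \<otimes> ?e) \<le> len (wp q) + len ?e" using len_mult_le q(3) e by blast
  ultimately show ?thesis using k m by (simp add: m_def)
qed

text \<open>The coefficients are \<open>sin ((k + 1) * \<theta>) / sin \<theta>\<close> and
  \<open>sin (k * \<theta>) / sin \<theta>\<close>, hence nonnegative while \<open>k\<close> is
  below the order of \<open>s t\<close>.\<close>

lemma alternating_act:
  assumes st: "s \<in> S" "t \<in> S" "s \<noteq> t" and \<theta>: "\<theta> = pi / real (ord (s \<otimes> t))"
  shows "act (wp (alternating k s t)) (sroot s) =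
    (if even k then plane s t (\<lambda>x. 0) (cheb \<theta> 1 0 (real k)) (cheb \<theta> 1 0 (real k - 1))
     else plane s t (\<lambda>x. 0) (cheb \<theta> 1 0 (real k - 1)) (cheb \<theta> 1 0 (real k)))"
proof -
  have c0: "coef r (\<lambda>x. 0) = 0" for r by (simp add: coef_def)
  show ?thesis
  proof (induction k)
    case 0
    have "sin \<theta> \<noteq> 0" using sin_angle_pos[OF st] \<theta> by simp
    then show ?case by (simp add: cheb_def plane_def)
  next
    case (Suc k)
    note rec = cheb_rec[of \<theta> 1 0 "real k"]
    have l: "wp (alternating k s t) \<in> carrier G" using alternating_lists[OF st(1,2)] by blast
    show ?case
    proof (cases "even k")
      case True
      then show ?thesis using Suc l st rec srefl_plane'[OF st c0]
        by (simp add: \<theta> add.commute)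
    next
      case False
      then show ?thesis using Suc l st rec srefl_plane[OF st c0]
        by (simp add: \<theta> add.commute)
    qed
  qed
qed

lemma cheb_nonneg:
  assumes "s \<in> S" "t \<in> S" "s \<noteq> t" and "0 \<le> n + 1" "n + 1 \<le> real (ord (s \<otimes> t))"
  shows "cheb (pi / real (ord (s \<otimes> t))) 1 0 n \<ge> 0"
proof -
  let ?m = "real (ord (s \<otimes> t))"
  have "(n + 1) * pi \<le> ?m * pi" using assms(5) by (intro mult_right_mono) auto
  then have "(n + 1) * (pi / ?m) \<le> pi"
    using ord_ge2[OF assms(1-3)] by (simp add: field_simps)
  then have "sin ((n + 1) * (pi / ?m)) \<ge> 0"
    using assms(4) by (intro sin_ge_zero) auto
  then show ?thesis using sin_angle_pos[OF assms(1-3)] by (simp add: cheb_def)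
qed

lemma plane_nonneg:
  assumes "\<And>x. act v (sroot s) x \<ge> 0" "\<And>x. act v (sroot t) x \<ge> 0" "a \<ge> 0" "b \<ge> 0"
  shows "act v (plane s t (\<lambda>x. 0) a b) x \<ge> 0"
  using assms by (simp add: plane_def act_lin)

text \<open>Split off from \<open>w\<close> a longest alternating suffix in \<open>s\<close> and a right descent \<open>t\<close>: the remaining factor
  has both \<open>s\<close> and \<open>t\<close> as ascents, and the suffix has fewer than \<open>ord (s t)\<close> letters since \<open>s\<close> is an ascent of \<open>w\<close>.\<close>

theorem act_root_nonneg:
  assumes "w \<in> carrier G" "s \<in> S" "len w < len (w \<otimes> s)"
  shows "act w (sroot s) x \<ge> 0"
  using assms
proof (induction "len w" arbitrary: w s x rule: less_induct)
  case less
  note w = less.prems(1) and s = less.prems(2) and asc = less.prems(3)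
  show ?case
  proof (cases "w = \<one>")
    case True
    then show ?thesis by (simp add: sroot_def)
  next
    case False
    then obtain t where t: "t \<in> S" "len (w \<otimes> t) < len w" using descent_exists w by blast
    then have st: "s \<noteq> t" using asc by auto
    let ?a = "\<lambda>k. wp (alternating k s t)"
    have a: "?a k \<in> carrier G" for k using alternating_lists[OF s t(1)] by blast
    have lena: "len (?a k) \<le> k" for k
      using word_length_le[OF alternating_lists[OF s t(1)], of k] by simp
    define Q where "Q k \<longleftrightarrow> (\<exists>v\<in>carrier G. w = v \<otimes> ?a k \<and> len w = len v + k)" for k
    have Q1: "Q 1" unfolding Q_def
    proof (intro bexI conjI)
      show "w = w \<otimes> t \<otimes> ?a 1" using w t by simp
      show "len w = len (w \<otimes> t) + 1" using len_descent[OF w t(1)] t(2) by simp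
    qed (use w t in auto)
    have bound: "\<And>k. Q k \<Longrightarrow> k \<le> len w" unfolding Q_def by auto
    define k where "k = (GREATEST k. Q k)"
    have Qk: "Q k" unfolding k_def using GreatestI_nat[of Q 1 "len w"] Q1 bound by blast
    have kmax: "Q j \<Longrightarrow> j \<le> k" for j unfolding k_def using Greatest_le_nat[of Q j "len w"] bound by blast
    have k1: "k \<ge> 1" using kmax[OF Q1] .
    then obtain k' where k': "k = Suc k'" by (cases k) auto
    obtain v where v: "v \<in> carrier G" "w = v \<otimes> ?a k" "len w = len v + k" using Qk Q_def by auto
    \<comment> \<open>A descent at the letter that would come next could be moved into the suffix,
      against the maximality of \<open>k\<close>.\<close>
    have asc1: "len v < len (v \<otimes> r)" if r: "r = (if even k then t else s)" for r
    proof (rule ccontr)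
      assume *: "\<not> len v < len (v \<otimes> r)"
      have rS: "r \<in> S" using r s t by auto
      have "len v = len (v \<otimes> r) + 1" using len_descent[OF v(1) rS] * by simp
      moreover have "w = v \<otimes> r \<otimes> ?a (Suc k)"
        using v(1,2) rS a[of k] r by (simp add: m_assoc)
      ultimately have "Q (Suc k)" unfolding Q_def using v rS by (intro bexI[of _ "v \<otimes> r"]) auto
      from kmax[OF this] show False by simp
    qed
    \<comment> \<open>Here \<open>r\<close> is the first letter of the suffix. Moving it back makes
      both factors shorter at once, so \<open>w\<close> would be shorter than it is.\<close>
    have asc2: "len v < len (v \<otimes> r)" if r: "r = (if even k then s else t)" for r
    proof (rule ccontr)
      assume *: "\<not> len v < len (v \<otimes> r)"
      have rS: "r \<in> S" using r s t by auto
      have "len v = len (v \<otimes> r) + 1" using len_descent[OF v(1) rS] * by simp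
      moreover have "w = v \<otimes> r \<otimes> ?a k'"
        using v(1,2) rS a[of k'] r k' by (simp add: m_assoc)
      moreover have "len (v \<otimes> r \<otimes> ?a k') \<le> len (v \<otimes> r) + len (?a k')"
        using v rS a by (intro len_mult_le) auto
      ultimately show False using lena[of k'] v(3) k' by simp
    qed
    have ascs: "len v < len (v \<otimes> s)" "len v < len (v \<otimes> t)" using asc1 asc2 by (auto split: if_splits)
    have lt: "len v < len w" using v k1 by simp
    have pos: "act v (sroot s) x \<ge> 0" "act v (sroot t) x \<ge> 0" for x
      using less.hyps[OF lt v(1)] s t(1) ascs by auto
    have km: "k < ord (s \<otimes> t)"
    proof (rule ccontr)
      assume "\<not> k < ord (s \<otimes> t)"
      then have "len (?a k \<otimes> s) < k" using alternating_long[OF s t(1) st] by simp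
      moreover have "len (w \<otimes> s) \<le> len v + len (?a k \<otimes> s)"
        using len_mult_le[of v "?a k \<otimes> s"] v s a by (simp add: m_assoc)
      ultimately show False using asc v(3) by simp
    qed
    have c: "cheb (pi / real (ord (s \<otimes> t))) 1 0 (real k) \<ge> 0" "cheb (pi / real (ord (s \<otimes> t))) 1 0 (real k - 1) \<ge> 0"
      using km k1 by (auto intro!: cheb_nonneg s t(1) st)
    have "act w (sroot s) = act v (act (?a k) (sroot s))" using v a by simp
    then show ?thesis
      using alternating_act[OF s t(1) st refl, of k] c pos by (auto intro!: plane_nonneg)
  qed
qed

lemma act_root_nonpos:
  assumes "w \<in> carrier G" "s \<in> S" "len (w \<otimes> s) < len w"
  shows "act w (sroot s) x \<le> 0"
  using act_root_nonneg[of "w \<otimes> s" s x] assms by (simp add: act_minus)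

text \<open>An element other than \<open>\<one>\<close> has a descent, whose root it sends to a
  negative one.\<close>

lemma act_faithful:
  assumes "w \<in> carrier G" "\<And>s. s \<in> S \<Longrightarrow> act w (sroot s) = sroot s"
  shows "w = \<one>"
proof (rule ccontr)
  assume "w \<noteq> \<one>"
  then obtain s where s: "s \<in> S" "len (w \<otimes> s) < len w" using descent_exists assms(1) by blast
  then have "sroot s s \<le> 0" using act_root_nonpos[OF assms(1) s, of s] assms(2) by simp
  then show False by (simp add: sroot_def)
qed


section \<open>The invariant inner product\<close>

text \<open>The standard product of the \<open>S\<close>-coordinates summed over the finite group.
  Invariance and definiteness on the span of the simple roots are immediate, so definiteness of the
  form behind \<open>coef\<close> need not be examined directly.\<close>

definition ip :: "('a \<Rightarrow> real) \<Rightarrow> ('a \<Rightarrow> real) \<Rightarrow> real" where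
  "ip v w = (\<Sum>g\<in>carrier G. \<Sum>x\<in>S. act g v x * act g w x)"

lemma ip_invariant:
  assumes "h \<in> carrier G" shows "ip (act h v) (act h w) = ip v w"
proof -
  have "ip (act h v) (act h w) = (\<Sum>g\<in>carrier G. \<Sum>x\<in>S. act (g \<otimes> h) v x * act (g \<otimes> h) w x)"
    using assms by (simp add: ip_def)
  also have "\<dots> = ip v w" unfolding ip_def
    by (rule sum.reindex_bij_witness[of _ "\<lambda>g. g \<otimes> inv h" "\<lambda>g. g \<otimes> h"])
      (use assms in \<open>auto simp: m_assoc\<close>)
  finally show ?thesis .
qed

lemma ip_lin: "ip (\<lambda>x. a * v x + b * w x) u = a * ip v u + b * ip w u"
  unfolding ip_def act_lin by (simp add: distrib_right sum.distrib sum_distrib_left mult.assoc)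

lemma ip_sym: "ip v w = ip w v"
  by (simp add: ip_def mult.commute)

lemma ip_self_zero:
  assumes "ip v v = 0" "x \<in> S" shows "v x = 0"
proof -
  have "\<forall>g\<in>carrier G. (\<Sum>x\<in>S. act g v x * act g v x) = 0"
    using assms(1) finite_carrier unfolding ip_def
    by (subst (asm) sum_nonneg_eq_0_iff) (auto intro: sum_nonneg)
  from bspec[OF this one_closed] have "(\<Sum>x\<in>S. v x * v x) = 0" by simp
  then show ?thesis using assms(2) finite_S by (subst (asm) sum_nonneg_eq_0_iff) auto
qed

text \<open>A simple reflection negates its root, so invariance of \<open>ip\<close> forces this
  proportionality; orthogonality to a simple root is then the same for \<open>coef\<close> and for
  \<open>ip\<close>.\<close>

lemma ip_coef: "s \<in> S \<Longrightarrow> coef s v * ip (sroot s) (sroot s) = 2 * ip v (sroot s)"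
proof -
  assume s: "s \<in> S"
  have "ip v (sroot s) = ip (srefl s v) (srefl s (sroot s))"
    using ip_invariant[of s v "sroot s"] s by simp
  also have "\<dots> = - ip (srefl s v) (sroot s)"
    using s ip_lin[of "- 1" "sroot s" 0 "sroot s" "srefl s v"] by (simp add: ip_sym)
  also have "ip (srefl s v) (sroot s) = ip v (sroot s) - coef s v * ip (sroot s) (sroot s)"
    using ip_lin[of 1 v "- coef s v" "sroot s" "sroot s"] srefl_eq[of s v] by simp
  finally show ?thesis by simp
qed

lemma ip_root_pos: "s \<in> S \<Longrightarrow> ip (sroot s) (sroot s) \<noteq> 0"
  using ip_self_zero[of "sroot s" s] by (auto simp: sroot_def)

lemma root_expansion:
  assumes "finite J" "\<And>x. x \<notin> J \<Longrightarrow> v x = 0"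
  shows "v = (\<lambda>x. \<Sum>j\<in>J. v j * sroot j x)"
proof
  fix x
  have "(\<Sum>j\<in>J. v j * sroot j x) = (\<Sum>j\<in>J. if j = x then v x else 0)"
    by (rule sum.cong) (auto simp: sroot_def)
  then show "v x = (\<Sum>j\<in>J. v j * sroot j x)" using assms by simp
qed

lemma ip_sum: "ip (\<lambda>x. \<Sum>i\<in>A. a i * v i x) w = (\<Sum>i\<in>A. a i * ip (v i) w)"
proof (induction A rule: infinite_finite_induct)
  case (insert i A)
  then show ?case using ip_lin[of "a i" "v i" 1 "\<lambda>x. \<Sum>i\<in>A. a i * v i x" w] by simp
qed (simp_all add: ip_def act_zero)

text \<open>Expanding \<open>v\<close> in the simple roots of \<open>J\<close>, all orthogonal to
  it, gives \<open>ip v v = 0\<close>.\<close>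

lemma coef_nondegenerate:
  assumes J: "J \<subseteq> S" and v: "\<And>x. x \<notin> J \<Longrightarrow> v x = 0" and c: "\<And>j. j \<in> J \<Longrightarrow> coef j v = 0"
  shows "v = (\<lambda>x. 0)"
proof
  fix x
  have fin: "finite J" using J finite_S finite_subset by auto
  have z: "ip v (sroot j) = 0" if "j \<in> J" for j
    using ip_coef[of j v] c[OF that] that J by auto
  have "ip v v = ip (\<lambda>x. \<Sum>j\<in>J. v j * sroot j x) v"
    using root_expansion[OF fin v] by simp
  also have "\<dots> = 0" using z by (simp add: ip_sum ip_sym[of _ v])
  finally show "v x = 0" using ip_self_zero[of v x] v J by blast
qed

section \<open>Reflections and the strong exchange condition\<close>

abbreviation refls :: "'a set" where "refls \<equiv> reflections G S"

text \<open>Carrying the reflection along with its root keeps both conjugation and the linear action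
  available; each reflection occurs with a root and its negative.\<close>

definition is_root :: "'a \<Rightarrow> ('a \<Rightarrow> real) \<Rightarrow> bool" where
  "is_root t b \<longleftrightarrow> (\<exists>w\<in>carrier G. \<exists>s\<in>S. t = w \<otimes> s \<otimes> inv w \<and> b = act w (sroot s))"

lemma is_root_simple: "s \<in> S \<Longrightarrow> is_root s (sroot s)"
  unfolding is_root_def by (intro bexI[of _ \<one>] bexI[of _ s]) auto

lemma is_root_closed: "is_root t b \<Longrightarrow> t \<in> carrier G"
  by (auto simp: is_root_def)

lemma is_root_refls: "is_root t b \<Longrightarrow> t \<in> refls"
  by (auto simp: is_root_def reflections_def)

lemma is_root_conj:
  assumes "is_root t b" "g \<in> carrier G" shows "is_root (g \<otimes> t \<otimes> inv g) (act g b)"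
proof -
  obtain w s where w: "w \<in> carrier G" "s \<in> S" "t = w \<otimes> s \<otimes> inv w" "b = act w (sroot s)"
    using assms by (auto simp: is_root_def)
  have "g \<otimes> t \<otimes> inv g = (g \<otimes> w) \<otimes> s \<otimes> inv (g \<otimes> w)"
    using w assms(2) by (simp add: m_assoc inv_mult_group)
  then show ?thesis unfolding is_root_def using w assms(2)
    by (intro bexI[of _ "g \<otimes> w"] bexI[of _ s]) auto
qed

lemma is_root_sign:
  assumes "is_root t b" shows "(\<forall>x. b x \<ge> 0) \<or> (\<forall>x. b x \<le> 0)"
proof -
  obtain w s where w: "w \<in> carrier G" "s \<in> S" "b = act w (sroot s)"
    using assms by (auto simp: is_root_def)
  show ?thesis
    using act_root_nonneg[OF w(1,2)] act_root_nonpos[OF w(1,2)] len_simple_ne[OF w(1,2)] w(3)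
    by (metis linorder_neqE_nat)
qed

lemma is_root_nonzero: "is_root t b \<Longrightarrow> b \<noteq> (\<lambda>x. 0)"
proof
  assume "is_root t b" "b = (\<lambda>x. 0)"
  then obtain w s where "w \<in> carrier G" "s \<in> S" "act w (sroot s) = (\<lambda>x. 0)"
    by (auto simp: is_root_def)
  then have "sroot s = (\<lambda>x. 0)" using act_eq_zero by blast
  then have "sroot s s = 0" by metis
  then show False by (simp add: sroot_def)
qed

lemma is_root_minus: "is_root t b \<Longrightarrow> is_root t (\<lambda>x. - b x)"
proof -
  assume "is_root t b"
  then obtain w s where w: "w \<in> carrier G" "s \<in> S" "t = w \<otimes> s \<otimes> inv w" "b = act w (sroot s)"
    by (auto simp: is_root_def)
  have "t = (w \<otimes> s) \<otimes> s \<otimes> inv (w \<otimes> s)"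
    using w by (simp add: inv_mult_group m_assoc[symmetric])
  then show ?thesis unfolding is_root_def using w
    by (intro bexI[of _ "w \<otimes> s"] bexI[of _ s]) (auto simp: act_minus)
qed

lemma pos_root_exists:
  assumes "t \<in> refls" obtains b where "is_root t b" "\<And>x. b x \<ge> 0"
proof -
  obtain b where b: "is_root t b" using assms by (auto simp: reflections_def is_root_def)
  show thesis
  proof (cases "\<forall>x. b x \<ge> 0")
    case True
    then show ?thesis using that b by blast
  next
    case False
    then have "\<And>x. - b x \<ge> 0" using is_root_sign[OF b] by auto
    then show ?thesis using that[of "\<lambda>x. - b x"] is_root_minus[OF b] by blast
  qed
qed

lemma act_reflection:
  assumes "is_root t b" obtains a where "act t v = (\<lambda>x. v x - a * b x)"
proof -
  obtain w s where w: "w \<in> carrier G" "s \<in> S" "t = w \<otimes> s \<otimes> inv w" "b = act w (sroot s)"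
    using assms by (auto simp: is_root_def)
  let ?u = "act (inv w) v"
  have "act t v = act w (\<lambda>x. 1 * ?u x + - coef s ?u * sroot s x)"
    using w srefl_eq[of s ?u] by simp
  also have "\<dots> = (\<lambda>x. v x - coef s ?u * b x)"
    unfolding act_lin using w by simp
  finally show thesis using that by blast
qed

lemma act_reflection_root:
  assumes "is_root t b" shows "act t b = (\<lambda>x. - b x)"
proof -
  obtain w s where w: "w \<in> carrier G" "s \<in> S" "t = w \<otimes> s \<otimes> inv w" "b = act w (sroot s)"
    using assms by (auto simp: is_root_def)
  then show ?thesis by (simp add: act_minus)
qed

lemma reflection_square:
  assumes "t \<in> refls" shows "t \<otimes> t = \<one>" "inv t = t" "t \<in> carrier G"
proof -
  obtain w s where w: "w \<in> carrier G" "s \<in> S" "t = w \<otimes> s \<otimes> inv w"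
    using assms by (auto simp: reflections_def)
  show c: "t \<in> carrier G" using w by simp
  have "t \<otimes> t = w \<otimes> (s \<otimes> ((inv w \<otimes> w) \<otimes> s)) \<otimes> inv w" using w by (simp only: w(3) m_assoc m_closed S_closed inv_closed)
  then show t2: "t \<otimes> t = \<one>" using w by simp
  show "inv t = t" using inv_equality[OF t2 c c] .
qed

text \<open>The product \<open>t s\<close> fixes the simple root and moves every vector by a
  multiple of it. Invariance of \<open>ip\<close> makes that multiple zero, and the action is
  faithful.\<close>

lemma reflection_unique:
  assumes r: "is_root t b" and s: "s \<in> S" and b: "b = (\<lambda>x. a * sroot s x)"
  shows "t = s"
proof -
  have a: "a \<noteq> 0" using is_root_nonzero[OF r] b by auto
  have t: "t \<in> carrier G" using is_root_closed[OF r] .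
  have "act t b = (\<lambda>x. - b x)" using act_reflection_root[OF r] .
  then have "(\<lambda>x. a * act t (sroot s) x) = (\<lambda>x. a * (- sroot s x))"
    unfolding b act_scale by simp
  then have ta: "act t (sroot s) = (\<lambda>x. - sroot s x)" using a unfolding fun_eq_iff mult_cancel_left by blast
  have fix_root: "act (t \<otimes> s) (sroot s) = sroot s"
    using t s ta by (simp add: act_minus)
  have "act (t \<otimes> s) v = v" for v
  proof -
    obtain c where c: "act t (srefl s v) = (\<lambda>x. srefl s v x - c * b x)"
      using act_reflection[OF r] .
    define d where "d = - coef s v - c * a"
    have d: "act (t \<otimes> s) v = (\<lambda>x. 1 * v x + d * sroot s x)"
      using t s c b by (simp add: d_def srefl_eq algebra_simps)
    have "ip v (sroot s) = ip (act (t \<otimes> s) v) (act (t \<otimes> s) (sroot s))"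
      using ip_invariant[of "t \<otimes> s" v "sroot s"] t s by (simp del: act_mult)
    also have "\<dots> = ip v (sroot s) + d * ip (sroot s) (sroot s)"
      unfolding fix_root d ip_lin by simp
    finally have "d = 0" using ip_root_pos[OF s] by simp
    then show ?thesis using d by simp
  qed
  then have "t \<otimes> s = \<one>" using act_faithful[of "t \<otimes> s"] t s by simp
  then have "t \<otimes> s \<otimes> s = s" using s by (simp del: S_cancel)
  then show ?thesis using t s by simp
qed

text \<open>Only the coordinate at \<open>s\<close> can change, so every other coordinate is both
  nonnegative and nonpositive. For roots this says that \<open>s\<close> makes no positive root
  negative except its own.\<close>

lemma srefl_sign_change:
  assumes "\<And>x. v x \<ge> 0" "\<And>x. srefl s v x \<le> 0"
  shows "v = (\<lambda>x. v s * sroot s x)"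
proof
  fix x
  show "v x = v s * sroot s x"
    using assms(1)[of x] assms(2)[of x] by (auto simp: srefl_def sroot_def split: if_splits)
qed

text \<open>Apply the letters from the right. At the letter where the image of \<open>b\<close>
  turns negative, that image is the root of the letter; deleting the letter multiplies the word by
  \<open>t\<close>.\<close>

lemma strong_exchange:
  assumes r: "is_root t b" and pos: "\<And>x. b x \<ge> 0"
    and "xs \<in> lists S" "\<And>x. act (wp xs) b x \<le> 0"
  shows "\<exists>ys\<in>lists S. length ys < length xs \<and> wp ys = wp xs \<otimes> t"
  using assms(3,4)
proof (induction xs rule: list.induct)
  case Nil
  then have "b x = 0" for x using pos[of x] by (simp add: antisym)
  then show ?case using is_root_nonzero[OF r] by auto
next
  case (Cons s xs)
  have s: "s \<in> S" "xs \<in> lists S" using Cons.prems(1) by auto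
  have t: "t \<in> carrier G" using is_root_closed[OF r] .
  have w: "wp xs \<in> carrier G" using s by blast
  have rw: "is_root (wp xs \<otimes> t \<otimes> inv (wp xs)) (act (wp xs) b)"
    using is_root_conj[OF r w] .
  show ?case
  proof (cases "\<forall>x. act (wp xs) b x \<le> 0")
    case True
    then obtain ys where ys: "ys \<in> lists S" "length ys < length xs" "wp ys = wp xs \<otimes> t"
      using Cons.IH s by blast
    then show ?thesis using s t w by (intro bexI[of _ "s # ys"]) (auto simp: m_assoc)
  next
    case False
    then have p: "\<And>x. act (wp xs) b x \<ge> 0" using is_root_sign[OF rw] by blast
    have n: "\<And>x. srefl s (act (wp xs) b) x \<le> 0" using Cons.prems(2) s w by simp
    have "wp xs \<otimes> t \<otimes> inv (wp xs) = s"
      using reflection_unique[OF rw s(1) srefl_sign_change[OF p n]] .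
    then have "s \<otimes> wp xs = wp xs \<otimes> t \<otimes> inv (wp xs) \<otimes> wp xs" by simp
    also have "\<dots> = wp xs \<otimes> t" using t w by (simp add: m_assoc)
    finally have "wp xs \<otimes> t = s \<otimes> wp xs" by simp
    then have e: "wp (s # xs) \<otimes> t = wp xs" using s t w by (simp add: m_assoc)
    show ?thesis
    proof (rule bexI[of _ xs], rule conjI)
      show "wp xs = wp (s # xs) \<otimes> t" using e by (rule sym)
    qed (simp, rule s(2))
  qed
qed

lemma len_reflection_less:
  assumes "is_root t b" "\<And>x. b x \<ge> 0" "u \<in> carrier G" "\<And>x. act u b x \<le> 0"
  shows "len (u \<otimes> t) < len u"
proof -
  obtain xs where xs: "xs \<in> lists S" "wp xs = u" "length xs = len u"
    using reduced_exists[OF assms(3)] .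
  obtain ys where "ys \<in> lists S" "length ys < length xs" "wp ys = u \<otimes> t"
    using strong_exchange[OF assms(1,2) xs(1)] assms(4) xs(2) by auto
  then show ?thesis using word_length_le[of ys S "u \<otimes> t"] xs(3) by simp
qed

lemma len_reflection_greater:
  assumes "is_root t b" "\<And>x. b x \<ge> 0" "u \<in> carrier G" "\<And>x. act u b x \<ge> 0"
  shows "len u < len (u \<otimes> t)"
proof -
  have t: "t \<in> refls" using is_root_refls[OF assms(1)] .
  note tt = reflection_square[OF t]
  have "len (u \<otimes> t \<otimes> t) < len (u \<otimes> t)"
  proof (rule len_reflection_less[OF assms(1,2)])
    show "act (u \<otimes> t) b x \<le> 0" for x
      using assms(3,4) tt act_reflection_root[OF assms(1)] by (simp add: act_minus)
  qed (use assms(3) tt in auto)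
  then show ?thesis using assms(3) tt by (simp add: m_assoc)
qed

lemma root_image_sign:
  assumes "is_root t b" "u \<in> carrier G"
  shows "(\<forall>x. act u b x \<ge> 0) \<or> (\<forall>x. act u b x \<le> 0)"
  using is_root_sign[OF is_root_conj[OF assms]] .

lemma len_reflection_iff:
  assumes "is_root t b" "\<And>x. b x \<ge> 0" "u \<in> carrier G"
  shows "len u < len (u \<otimes> t) \<longleftrightarrow> (\<forall>x. act u b x \<ge> 0)"
    and "len (u \<otimes> t) < len u \<longleftrightarrow> (\<forall>x. act u b x \<le> 0)"
  using root_image_sign[OF assms(1,3)] len_reflection_greater[OF assms] len_reflection_less[OF assms]
  by (meson order.asym)+

section \<open>Parabolic subgroups\<close>

definition parab :: "'a set \<Rightarrow> 'a set" where "parab J = wp ` lists J"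

lemma parab_closed: "J \<subseteq> S \<Longrightarrow> w \<in> parab J \<Longrightarrow> w \<in> carrier G"
  using simple_closed by (auto simp: parab_def intro!: word_prod_closed)

lemma parab_one [simp]: "\<one> \<in> parab J"
  unfolding parab_def by (rule image_eqI[of _ _ "[]"]) auto

lemma parab_simple: "J \<subseteq> S \<Longrightarrow> s \<in> J \<Longrightarrow> s \<in> parab J"
  unfolding parab_def by (rule image_eqI[of _ _ "[s]"]) auto

lemma parab_mult:
  assumes "J \<subseteq> S" "u \<in> parab J" "v \<in> parab J" shows "u \<otimes> v \<in> parab J"
proof -
  obtain xs ys where "xs \<in> lists J" "u = wp xs" "ys \<in> lists J" "v = wp ys"
    using assms by (auto simp: parab_def)
  then show ?thesis unfolding parab_def using assms(1) simple_closed
    by (intro image_eqI[of _ _ "xs @ ys"]) (auto simp: subset_iff intro!: word_prod_append[symmetric])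
qed

lemma parab_inv:
  assumes "J \<subseteq> S" "u \<in> parab J" shows "inv u \<in> parab J"
proof -
  obtain xs where "xs \<in> lists J" "u = wp xs" using assms by (auto simp: parab_def)
  then show ?thesis unfolding parab_def using assms(1) simple_closed
    by (intro image_eqI[of _ _ "rev xs"]) (auto simp: subset_iff intro!: word_prod_rev[symmetric] S_inv)
qed

lemma parab_full: "parab S = carrier G"
  using word_exists parab_closed[of S] by (auto simp: parab_def image_iff) metis

lemma parab_mono: "I \<subseteq> J \<Longrightarrow> parab I \<subseteq> parab J"
  unfolding parab_def by (intro image_mono lists_mono)

lemma parab_induct [consumes 2, case_names one snoc]:
  assumes "J \<subseteq> S" "z \<in> parab J" and "P \<one>"
    and "\<And>y j. y \<in> parab J \<Longrightarrow> j \<in> J \<Longrightarrow> P y \<Longrightarrow> P (y \<otimes> j)"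
  shows "P z"
proof -
  obtain zs where zs: "zs \<in> lists J" "z = wp zs" using assms(2) by (auto simp: parab_def)
  have "P (wp zs)" using zs(1)
  proof (induction zs rule: rev_induct)
    case Nil
    then show ?case using assms(3) by simp
  next
    case (snoc j zs)
    then have "wp (zs @ [j]) = wp zs \<otimes> j"
      using assms(1) simple_closed by (subst word_prod_append) (auto simp: subset_iff)
    then show ?case using snoc assms(4) by (auto simp: parab_def)
  qed
  then show ?thesis using zs by simp
qed

lemma parab_act_outside:
  assumes "J \<subseteq> S" "z \<in> parab J" "x \<notin> J" shows "act z v x = v x"
proof -
  obtain zs where zs: "zs \<in> lists J" "z = wp zs" using assms(2) by (auto simp: parab_def)
  have "zs \<in> lists S" using zs assms(1) by auto
  moreover have "foldr srefl zs v x = v x" using zs(1) assms(3)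
    by (induction zs) (auto simp: srefl_def)
  ultimately show ?thesis using zs by (simp add: act_word)
qed

text \<open>The root \<open>y \<alpha>\<close> is a combination of the simple roots of
  \<open>J\<close> with coefficients of one sign, and \<open>x\<close> keeps all those roots
  positive.\<close>

lemma parab_root_sign:
  assumes J: "J \<subseteq> S" "y \<in> parab J" "j \<in> J" and x: "x \<in> carrier G"
    and x_pos: "\<And>j z. j \<in> J \<Longrightarrow> act x (sroot j) z \<ge> 0"
  shows "len y < len (y \<otimes> j) \<Longrightarrow> act (x \<otimes> y) (sroot j) z \<ge> 0"
    and "len (y \<otimes> j) < len y \<Longrightarrow> act (x \<otimes> y) (sroot j) z \<le> 0"
proof -
  have y: "y \<in> carrier G" using J parab_closed by blast
  have fin: "finite J" using J finite_S finite_subset by auto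
  let ?v = "act y (sroot j)"
  have "?v z = 0" if "z \<notin> J" for z
    using parab_act_outside[OF J(1,2) that] that J(3) by (auto simp: sroot_def)
  then have "?v = (\<lambda>z. \<Sum>j\<in>J. ?v j * sroot j z)" using root_expansion[OF fin] by blast
  then have "act x ?v = act x (\<lambda>z. \<Sum>j\<in>J. ?v j * sroot j z)" by simp
  then have e: "act (x \<otimes> y) (sroot j) z = (\<Sum>j\<in>J. ?v j * act x (sroot j) z)"
    using x y by (simp add: act_sum)
  show "act (x \<otimes> y) (sroot j) z \<ge> 0" if "len y < len (y \<otimes> j)"
    unfolding e using act_root_nonneg[OF y _ that] J x_pos by (intro sum_nonneg mult_nonneg_nonneg) auto
  show "act (x \<otimes> y) (sroot j) z \<le> 0" if "len (y \<otimes> j) < len y"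
    unfolding e using act_root_nonpos[OF y _ that] J x_pos by (intro sum_nonpos mult_nonpos_nonneg) auto
qed

lemma len_ascent_iff:
  assumes "w \<in> carrier G" "s \<in> S"
  shows "len w < len (w \<otimes> s) \<longleftrightarrow> (\<forall>x. act w (sroot s) x \<ge> 0)"
    and "len (w \<otimes> s) < len w \<longleftrightarrow> (\<forall>x. act w (sroot s) x \<le> 0)"
  using len_reflection_iff[OF is_root_simple[OF assms(2)] _ assms(1)] by (auto simp: sroot_def)

text \<open>By \<open>parab_root_sign\<close>, a letter of \<open>J\<close> multiplied on the right
  changes \<open>len (x y)\<close> and \<open>len y\<close> in the same direction.\<close>

lemma len_coset:
  assumes J: "J \<subseteq> S" "z \<in> parab J" and x: "x \<in> carrier G"
    and asc: "\<And>j. j \<in> J \<Longrightarrow> len x < len (x \<otimes> j)"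
  shows "len (x \<otimes> z) = len x + len z"
  using J
proof (induction rule: parab_induct)
  case one
  then show ?case using x by simp
next
  case (snoc y j)
  have y: "y \<in> carrier G" "j \<in> S" using snoc J parab_closed by blast+
  have pos: "\<And>j z. j \<in> J \<Longrightarrow> act x (sroot j) z \<ge> 0"
    using act_root_nonneg[OF x _ asc] J(1) by blast
  note sgn = parab_root_sign[OF J(1) snoc(1,2) x pos]
  show ?case
  proof (cases "len y < len (y \<otimes> j)")
    case True
    then have "len (x \<otimes> y) < len (x \<otimes> y \<otimes> j)" using sgn(1) len_ascent_iff[of "x \<otimes> y" j] x y by auto
    then show ?thesis using True snoc(3) len_ascent[of "x \<otimes> y" j] len_ascent[of y j] x y
      by (simp add: m_assoc)
  next
    case False
    then have l: "len y = len (y \<otimes> j) + 1" using len_descent y by blast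
    then have "len (x \<otimes> y \<otimes> j) < len (x \<otimes> y)" using sgn(2) len_ascent_iff[of "x \<otimes> y" j] x y by auto
    then show ?thesis using l snoc(3) len_descent[of "x \<otimes> y" j] x y
      by (simp add: m_assoc)
  qed
qed

lemma coset_decomposition:
  assumes J: "J \<subseteq> S" and w: "w \<in> carrier G"
  obtains x z where "x \<in> carrier G" "z \<in> parab J" "w = x \<otimes> z" "\<And>j. j \<in> J \<Longrightarrow> len x < len (x \<otimes> j)"
proof -
  \<comment> \<open>The minimal representative of the coset is \<open>w z\<close>, an element of
    least length in it.\<close>
  obtain z where z: "z \<in> parab J" and min: "\<And>y. y \<in> parab J \<Longrightarrow> len (w \<otimes> z) \<le> len (w \<otimes> y)"
    using ex_has_least_nat[of "\<lambda>z. z \<in> parab J" \<one> "\<lambda>z. len (w \<otimes> z)"] by auto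
  have zc: "z \<in> carrier G" using z parab_closed[OF J] by blast
  show thesis
  proof (rule that[of "w \<otimes> z" "inv z"])
    show "w \<otimes> z \<in> carrier G" "w = w \<otimes> z \<otimes> inv z" using w zc by (simp_all add: m_assoc)
    show "inv z \<in> parab J" using parab_inv[OF J z] .
    fix j assume j: "j \<in> J"
    have "len (w \<otimes> z) \<le> len (w \<otimes> (z \<otimes> j))" using min parab_mult[OF J z parab_simple[OF J j]] .
    moreover have "len (w \<otimes> z \<otimes> j) \<noteq> len (w \<otimes> z)" using len_simple_ne w zc j J by auto
    ultimately show "len (w \<otimes> z) < len (w \<otimes> z \<otimes> j)" using w zc j J by (simp add: m_assoc subset_iff)
  qed
qed

text \<open>The root of \<open>s\<close> keeps its own coordinate \<open>1\<close> under
  \<open>z\<close>, so its image cannot be negative.\<close>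

lemma len_outside:
  assumes "J \<subseteq> S" "z \<in> parab J" "s \<in> S" "s \<notin> J" shows "len (z \<otimes> s) = len z + 1"
proof -
  have z: "z \<in> carrier G" using assms parab_closed by blast
  have "act z (sroot s) s = 1" using parab_act_outside[OF assms(1,2,4)] by (simp add: sroot_def)
  then have "\<not> len (z \<otimes> s) < len z" using act_root_nonpos[OF z assms(3), of s] by fastforce
  then show ?thesis using len_ascent z assms(3) by blast
qed

text \<open>The minimal coset representative \<open>x\<close> of \<open>w\<close> must be trivial. A
  descent \<open>s\<close> of \<open>x\<close> would lie outside \<open>J\<close>, where both
  \<open>w\<close> and \<open>z\<close> preserve coordinates, so \<open>x\<close> would send the
  root of \<open>s\<close> to a vector with \<open>s\<close>-coordinate \<open>1\<close> instead of
  a negative one.\<close>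

lemma parab_memberI:
  assumes J: "J \<subseteq> S" and w: "w \<in> carrier G"
    and fixed: "\<And>s x. s \<in> S \<Longrightarrow> x \<notin> J \<Longrightarrow> act w (sroot s) x = sroot s x"
  shows "w \<in> parab J"
proof -
  obtain x z where xz: "x \<in> carrier G" "z \<in> parab J" "w = x \<otimes> z" "\<And>j. j \<in> J \<Longrightarrow> len x < len (x \<otimes> j)"
    using coset_decomposition[OF J w] by blast
  have z: "z \<in> carrier G" using xz parab_closed[OF J] by blast
  have "x = \<one>"
  proof (rule ccontr)
    assume "x \<noteq> \<one>"
    then obtain s where s: "s \<in> S" "len (x \<otimes> s) < len x" using descent_exists xz(1) by blast
    then have sJ: "s \<notin> J" using xz(4) by force
    let ?v = "act (inv z) (sroot s)"
    have fin: "finite S" by (rule finite_S)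
    have "?v y = 0" if "y \<notin> S" for y
      using parab_act_outside[OF subset_refl, of "inv z" y] that z s by (auto simp: parab_full sroot_def)
    then have ve: "?v = (\<lambda>y. \<Sum>j\<in>S. ?v j * sroot j y)" using root_expansion[OF fin] by blast
    have "act w ?v s = (\<Sum>j\<in>S. ?v j * act w (sroot j) s)"
      by (subst ve) (simp only: act_sum)
    also have "\<dots> = (\<Sum>j\<in>S. ?v j * sroot j s)" using fixed sJ by simp
    also have "\<dots> = ?v s" using ve by metis
    also have "\<dots> = 1" using parab_act_outside[OF J parab_inv[OF J xz(2)] sJ] by (simp add: sroot_def)
    finally have "act x (sroot s) s = 1" using xz z by (simp add: xz(3))
    then show False using act_root_nonpos[OF xz(1) s, of s] by simp
  qed
  then show ?thesis using xz z by simp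
qed

text \<open>An element of maximal length makes all simple roots of \<open>J\<close> negative, so
  multiplying by it exchanges ascents and descents in the letters of \<open>J\<close>.\<close>

lemma longest_exists:
  assumes J: "J \<subseteq> S"
  obtains z where "z \<in> parab J" "\<And>y. y \<in> parab J \<Longrightarrow> len (z \<otimes> y) + len y = len z"
proof -
  have "parab J \<subseteq> carrier G" using parab_closed[OF J] by blast
  then have "finite (parab J)" using finite_carrier finite_subset by blast
  then obtain z where z: "z \<in> parab J" and max: "\<And>y. y \<in> parab J \<Longrightarrow> len y \<le> len z"
    using ex_has_greatest_nat[of "\<lambda>y. y \<in> parab J" \<one> len "Suc (Max (len ` parab J))"]
    by (auto simp: less_Suc_eq_le)
  have zc: "z \<in> carrier G" using z parab_closed[OF J] by blast
  have neg: "act z (sroot j) x \<le> 0" if j: "j \<in> J" for j x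
  proof -
    have "len (z \<otimes> j) \<le> len z" using max parab_mult[OF J z parab_simple[OF J j]] by blast
    then have "len (z \<otimes> j) < len z" using len_simple_ne[of z j] zc j J by fastforce
    then show ?thesis using act_root_nonpos zc j J by blast
  qed
  have "len (z \<otimes> y) + len y = len z" if "y \<in> parab J" for y
    using J that
  proof (induction rule: parab_induct)
    case one
    then show ?case using zc by simp
  next
    case (snoc y j)
    have y: "y \<in> carrier G" "j \<in> S" using snoc J parab_closed by blast+
    have fin: "finite J" using J finite_S finite_subset by auto
    let ?v = "act y (sroot j)"
    have "?v x = 0" if "x \<notin> J" for x
      using parab_act_outside[OF J snoc(1) that] that snoc(2) by (auto simp: sroot_def)
    then have "?v = (\<lambda>z. \<Sum>j\<in>J. ?v j * sroot j z)" using root_expansion[OF fin] by blast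
    then have "act z ?v = act z (\<lambda>z. \<Sum>j\<in>J. ?v j * sroot j z)" by simp
    then have e: "act (z \<otimes> y) (sroot j) x = (\<Sum>j\<in>J. ?v j * act z (sroot j) x)" for x
      using zc y by (simp add: act_sum)
    show ?case
    proof (cases "len y < len (y \<otimes> j)")
      case True
      then have "\<forall>x. act (z \<otimes> y) (sroot j) x \<le> 0"
        unfolding e using act_root_nonneg[OF y True] neg
        by (intro allI sum_nonpos mult_nonneg_nonpos) auto
      then have "len (z \<otimes> y \<otimes> j) < len (z \<otimes> y)" using len_ascent_iff[of "z \<otimes> y" j] zc y by auto
      then show ?thesis using True snoc(3) len_descent[of "z \<otimes> y" j] len_ascent[of y j] zc y
        by (simp add: m_assoc)
    next
      case False
      then have l: "len y = len (y \<otimes> j) + 1" using len_descent y by blast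
      then have "\<forall>x. act (z \<otimes> y) (sroot j) x \<ge> 0"
        unfolding e using act_root_nonpos[OF y] neg
        by (intro allI sum_nonneg mult_nonpos_nonpos) auto
      then have "len (z \<otimes> y) < len (z \<otimes> y \<otimes> j)" using len_ascent_iff[of "z \<otimes> y" j] zc y by auto
      then show ?thesis using l snoc(3) len_ascent[of "z \<otimes> y" j] zc y
        by (simp add: m_assoc)
    qed
  qed
  then show thesis using that z by blast
qed


section \<open>Reflection factorisations of a Coxeter element\<close>

lemma parab_word: "wp xs \<in> parab (set xs)"
  by (auto simp: parab_def)

text \<open>Since the letters are distinct, only the first letter \<open>s\<close> can change the
  coordinate at \<open>s\<close>. A vector fixed by the whole word is therefore already fixed by the
  tail and by \<open>s\<close> separately.\<close>

lemma coxeter_element_fixed: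
  assumes "distinct xs" "xs \<in> lists S" "act (wp xs) v = v" "j \<in> set xs"
  shows "coef j v = 0"
  using assms
proof (induction xs rule: list.induct)
  case (Cons s xs)
  have s: "s \<in> S" "xs \<in> lists S" "s \<notin> set xs" using Cons.prems(1,2) by auto
  let ?w = "act (wp xs) v"
  have e: "srefl s ?w = v" using Cons.prems(3) s by simp
  have out: "?w s = v s"
    using parab_act_outside[of "set xs" "wp xs" s v] s by (auto simp: parab_def)
  have wv: "?w = v"
  proof
    fix x show "?w x = v x" using fun_cong[OF e, of x] out by (auto simp: srefl_def split: if_splits)
  qed
  have "coef s v = 0" using fun_cong[OF e, of s] unfolding wv by (simp add: srefl_def)
  then show ?case using Cons.IH[OF _ s(2) wv] Cons.prems(1,4) by auto
qed simp

lemma coxeter_element_no_fixed: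
  assumes "distinct xs" "xs \<in> lists S" "act (wp xs) v = v" "\<And>x. x \<notin> set xs \<Longrightarrow> v x = 0"
  shows "v = (\<lambda>x. 0)"
  using coef_nondegenerate[of "set xs" v] coxeter_element_fixed[OF assms(1-3)] assms(2,4) by auto

text \<open>With \<open>c\<close> the Coxeter element of \<open>J\<close>, the vectors \<open>c \<alpha>\<^sub>j - \<alpha>\<^sub>j\<close> are independent and lie in the span
  of the roots of any reflection factorisation of \<open>c\<close>; with at most \<open>card J\<close> factors, that span has
  to be the span of the simple roots of \<open>J\<close>.\<close>

lemma coxeter_factors_in_parab:
  assumes dist: "distinct xs" and xs: "xs \<in> lists S" and ts: "ts \<in> lists refls"
    and len_ts: "length ts \<le> length xs" and eq: "wp ts = wp xs"
  shows "set ts \<subseteq> parab (set xs)"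
proof -
  let ?J = "set xs"
  interpret fv: vector_space "\<lambda>(a::real) (v::'a \<Rightarrow> real) x. a * v x"
    by unfold_locales (auto simp: algebra_simps fun_eq_iff)
  have J: "?J \<subseteq> S" using xs by auto
  have tc: "set ts \<subseteq> carrier G" using ts reflection_square(3) by auto
  have "\<forall>t\<in>set ts. \<exists>b. is_root t b" using ts pos_root_exists by (metis in_listsD)
  then obtain b where b: "\<And>t. t \<in> set ts \<Longrightarrow> is_root t (b t)" by metis
  let ?B = "b ` set ts"
  \<comment> \<open>Each reflection displaces a vector by a multiple of its root; the displacement
    by a product telescopes.\<close>
  have span: "(\<lambda>x. act (wp ys) v x - v x) \<in> fv.span ?B" if "set ys \<subseteq> set ts" for ys v
    using that
  proof (induction ys)
    case Nil
    have "(\<lambda>x. 0::real) \<in> fv.span ?B" using fv.span_zero[of ?B] by (simp add: zero_fun_def)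
    then show ?case by simp
  next
    case (Cons y ys)
    obtain a where a: "act y (act (wp ys) v) = (\<lambda>x. act (wp ys) v x - a * b y x)"
      using act_reflection[OF b[of y]] Cons.prems by auto
    have "y \<in> carrier G" "wp ys \<in> carrier G" using Cons.prems tc by (auto intro!: word_prod_closed)
    then have "(\<lambda>x. act (wp (y # ys)) v x - v x) =
        (\<lambda>x. act (wp ys) v x - v x) - (\<lambda>x. a * b y x)"
      using a by (auto simp: fun_eq_iff)
    moreover have "(\<lambda>x. a * b y x) \<in> fv.span ?B"
      using Cons.prems by (intro fv.span_scale fv.span_base) auto
    ultimately show ?case using Cons fv.span_diff by simp
  qed
  define D where "D j = (\<lambda>x. act (wp xs) (sroot j) x - sroot j x)" for j
  \<comment> \<open>A linear relation among the \<open>D j\<close> says that the combination of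
    simple roots with the same coefficients is fixed by the Coxeter element.\<close>
  have zero: "\<forall>j\<in>?J. a j = 0" if "(\<lambda>x. \<Sum>j\<in>?J. a j * D j x) = (\<lambda>x. 0)" for a
  proof -
    let ?v = "\<lambda>x. \<Sum>j\<in>?J. a j * sroot j x"
    have v: "?v x = (if x \<in> ?J then a x else 0)" for x
    proof -
      have "?v x = (\<Sum>j\<in>?J. if j = x then a x else 0)" by (rule sum.cong) (auto simp: sroot_def)
      then show ?thesis by simp
    qed
    have "act (wp xs) ?v x - ?v x = 0" for x
      using fun_cong[OF that, of x]
      by (simp add: act_sum D_def right_diff_distrib sum_subtractf)
    then have "act (wp xs) ?v = ?v" by auto
    then have "?v = (\<lambda>x. 0)"
      by (rule coxeter_element_no_fixed[OF dist xs]) (simp add: v)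
    then have "?v j = 0" for j by (rule fun_cong)
    then have "a j = 0" if "j \<in> ?J" for j using v[of j] that by simp
    then show ?thesis by blast
  qed
  have inj: "inj_on D ?J"
  proof (rule inj_onI, rule ccontr)
    fix i j assume ij: "i \<in> ?J" "j \<in> ?J" "D i = D j" "i \<noteq> j"
    let ?a = "\<lambda>k. if k = i then 1 else if k = j then - 1 else (0::real)"
    have "(\<Sum>k\<in>?J. ?a k * D k x) = 0" for x
    proof -
      have "(\<Sum>k\<in>?J. ?a k * D k x) = (\<Sum>k\<in>?J. (if k = i then D i x else 0) - (if k = j then D j x else 0))"
        by (rule sum.cong) (use ij in auto)
      also have "\<dots> = 0" using ij by (simp add: sum_subtractf)
      finally show ?thesis .
    qed
    then show False using zero[of ?a] ij by (auto split: if_splits)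
  qed
  have sum_apply: "(\<Sum>j\<in>A. f j) x = (\<Sum>j\<in>A. f j x)" for A and f :: "'a \<Rightarrow> 'a \<Rightarrow> real" and x
    by (induction A rule: infinite_finite_induct) auto
  have indep: "fv.independent (D ` ?J)"
  proof
    assume "fv.dependent (D ` ?J)"
    then obtain u where u: "\<exists>v\<in>D ` ?J. u v \<noteq> 0" "(\<Sum>v\<in>D ` ?J. (\<lambda>x. u v * v x)) = 0"
      unfolding fv.dependent_finite[OF finite_imageI[OF finite_set]] by blast
    then have "(\<Sum>j\<in>?J. (\<lambda>x. u (D j) * D j x)) = (\<lambda>x. 0)"
      using sum.reindex[OF inj, of "\<lambda>v x. u v * v x"] by (simp add: zero_fun_def o_def)
    then have "(\<lambda>x. \<Sum>j\<in>?J. u (D j) * D j x) = (\<lambda>x. 0)" by (simp add: fun_eq_iff sum_apply)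
    then show False using zero[of "\<lambda>j. u (D j)"] u(1) by auto
  qed
  have "D j \<in> fv.span ?B" for j unfolding D_def using span[of ts "sroot j"] eq by simp
  then have "D ` ?J \<subseteq> fv.span ?B" by auto
  note DB = this
  have card: "card ?B \<le> card (D ` ?J)"
    using card_image[OF inj] distinct_card[OF dist] card_image_le[of "set ts" b] card_length[of ts] len_ts
    by simp
  \<comment> \<open>A root outside the span of the \<open>D j\<close> could be added to them, giving
    more independent vectors in the span of \<open>?B\<close> than \<open>?B\<close> has
    elements.\<close>
  have "?B \<subseteq> fv.span (D ` ?J)"
  proof (rule subsetI, rule ccontr)
    fix v assume v: "v \<in> ?B" "v \<notin> fv.span (D ` ?J)"
    then have "fv.independent (insert v (D ` ?J))" using indep fv.independent_insertI by blast
    moreover have "insert v (D ` ?J) \<subseteq> fv.span ?B" using DB v fv.span_base by blast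
    ultimately have "card (insert v (D ` ?J)) \<le> card ?B"
      using fv.independent_span_bound[of ?B] by blast
    moreover have "v \<notin> D ` ?J" using v fv.span_base by blast
    ultimately show False using card by simp
  qed
  also have "\<dots> \<subseteq> {v. \<forall>x. x \<notin> ?J \<longrightarrow> v x = 0}"
  proof (rule fv.span_minimal)
    show "D ` ?J \<subseteq> {v. \<forall>x. x \<notin> ?J \<longrightarrow> v x = 0}"
      using parab_act_outside[OF J, of "wp xs"] by (auto simp: D_def parab_word)
    show "fv.subspace {v. \<forall>x. x \<notin> ?J \<longrightarrow> v x = 0}" by (auto simp: fv.subspace_def)
  qed
  finally have supp: "b t x = 0" if "t \<in> set ts" "x \<notin> ?J" for t x
    using that by auto
  show ?thesis
  proof
    fix t assume t: "t \<in> set ts"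
    show "t \<in> parab ?J"
    proof (rule parab_memberI[OF J])
      show "t \<in> carrier G" using t tc by auto
      fix s x assume "s \<in> S" "x \<notin> ?J"
      moreover obtain a where "act t (sroot s) = (\<lambda>x. sroot s x - a * b t x)"
        using act_reflection[OF b[OF t]] .
      ultimately show "act t (sroot s) x = sroot s x" using supp[OF t] by simp
    qed
  qed
qed

section \<open>Rotation of a Coxeter word\<close>

text \<open>\<open>hits n xs t\<close>: after \<open>n\<close> rotations of the word, each conjugating \<open>t\<close> by the letter moved to the end,
  \<open>t\<close> has become the initial letter.\<close>

fun hits :: "nat \<Rightarrow> 'a list \<Rightarrow> 'a \<Rightarrow> bool" where
  "hits 0 xs t \<longleftrightarrow> t = hd xs"
| "hits (Suc n) xs t \<longleftrightarrow> hits n (rotate1 xs) (hd xs \<otimes> t \<otimes> hd xs)"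

text \<open>With \<open>zs = []\<close> this describes a full turn: the word returns to itself and
  \<open>t\<close> is conjugated by the inverse of its product.\<close>

lemma hits_prefix:
  assumes "ys \<in> lists S" "t \<in> carrier G"
  shows "hits (length ys + n) (ys @ zs) t \<longleftrightarrow> hits n (zs @ ys) (inv (wp ys) \<otimes> t \<otimes> wp ys)"
  using assms
proof (induction ys arbitrary: zs t rule: list.induct)
  case (Cons y ys)
  have y: "y \<in> S" "ys \<in> lists S" "wp ys \<in> carrier G" using Cons.prems by auto
  have "inv (wp (y # ys)) \<otimes> t \<otimes> wp (y # ys) = inv (wp ys) \<otimes> (y \<otimes> t \<otimes> y) \<otimes> wp ys"
    using y Cons.prems(2) by (simp add: inv_mult_group m_assoc)
  then show ?case using Cons.IH[of "y \<otimes> t \<otimes> y" "zs @ [y]"] y Cons.prems(2) by simp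
qed simp

text \<open>A letter can turn the current positive root negative only if the current reflection is
  that letter, which would be a hit.\<close>

lemma eternal_positive:
  assumes "xs \<in> lists S" "xs = ys @ zs" "is_root t b" "\<And>x. b x \<ge> 0" "\<And>n. \<not> hits n xs t"
  shows "act (inv (wp ys)) b x \<ge> 0"
  using assms(2)
proof (induction ys arbitrary: x zs rule: rev_induct)
  case Nil
  then show ?case using assms(4) by simp
next
  case (snoc y ys)
  have ys: "ys \<in> lists S" "y \<in> S" "wp ys \<in> carrier G" using snoc.prems assms(1) by auto
  have t: "t \<in> carrier G" using is_root_closed[OF assms(3)] .
  have e: "inv (wp (ys @ [y])) = y \<otimes> inv (wp ys)"
    using ys by (simp add: word_prod_append inv_mult_group)
  have pos: "act (inv (wp ys)) b x \<ge> 0" for x using snoc by simp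
  let ?r = "inv (wp ys) \<otimes> t \<otimes> wp ys"
  have r: "is_root ?r (act (inv (wp ys)) b)" using is_root_conj[OF assms(3), of "inv (wp ys)"] ys by simp
  have "\<not> hits (length ys + 0) (ys @ y # zs) t" using assms(5) snoc.prems by simp
  then have ne: "?r \<noteq> y" using hits_prefix[OF ys(1) t, of 0 "y # zs"] by simp
  have r': "is_root (y \<otimes> ?r \<otimes> inv y) (act y (act (inv (wp ys)) b))"
    using is_root_conj[OF r] ys by blast
  have "\<forall>x. act y (act (inv (wp ys)) b) x \<ge> 0"
  proof (rule ccontr)
    assume "\<not> ?thesis"
    then have "\<And>x. srefl y (act (inv (wp ys)) b) x \<le> 0" using is_root_sign[OF r'] ys by auto
    then show False using reflection_unique[OF r ys(2) srefl_sign_change[OF pos]] ne by blast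
  qed
  then show ?case using e ys by simp
qed

text \<open>A reflection never hit is still never hit after a full turn, so
  \<open>eternal_positive\<close> applies again and all images of \<open>b\<close> under powers of
  the inverse Coxeter element stay positive.\<close>

lemma hits_exists:
  assumes dist: "distinct xs" and xs: "xs \<in> lists S" and t: "t \<in> refls" "t \<in> parab (set xs)"
  shows "\<exists>n. hits n xs t"
proof (rule ccontr)
  assume no: "\<nexists>n. hits n xs t"
  let ?c = "wp xs" and ?J = "set xs"
  have J: "?J \<subseteq> S" using xs by auto
  have c: "?c \<in> carrier G" using xs by auto
  obtain b where b: "is_root t b" "\<And>x. b x \<ge> 0" using pos_root_exists[OF t(1)] by blast
  have tc: "t \<in> carrier G" using reflection_square(3)[OF t(1)] .
  let ?g = "inv ?c"
  have g: "?g \<in> carrier G" using c by simp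
  have inv: "(\<forall>n. \<not> hits n xs (?g [^] k \<otimes> t \<otimes> inv (?g [^] k))) \<and> (\<forall>x. act (?g [^] k) b x \<ge> 0)" for k :: nat
  proof (induction k)
    case 0
    then show ?case using no b tc by simp
  next
    case (Suc k)
    let ?t = "?g [^] k \<otimes> t \<otimes> inv (?g [^] k)" and ?b = "act (?g [^] k) b"
    have gk: "?g [^] k \<in> carrier G" using g by simp
    have r: "is_root ?t ?b" using is_root_conj[OF b(1) gk] .
    have e: "?g [^] Suc k = ?g \<otimes> ?g [^] k" using nat_pow_Suc2[OF g] .
    have e2: "?g [^] Suc k \<otimes> t \<otimes> inv (?g [^] Suc k) = ?g \<otimes> ?t \<otimes> ?c"
      unfolding e using c gk tc by (simp add: inv_mult_group m_assoc)
    have "\<not> hits n xs (?g [^] Suc k \<otimes> t \<otimes> inv (?g [^] Suc k))" for n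
    proof -
      have "\<not> hits (length xs + n) (xs @ []) ?t" using Suc by simp
      then show ?thesis unfolding e2 using hits_prefix[OF xs, of ?t n "[]"] gk tc by simp
    qed
    moreover have "act (?g [^] Suc k) b x \<ge> 0" for x
      using eternal_positive[OF xs _ r, of xs "[]" x] Suc gk g unfolding e by simp
    ultimately show ?case by blast
  qed
  have supp: "b x = 0" if "x \<notin> ?J" for x
    using parab_act_outside[OF J t(2) that, of b] act_reflection_root[OF b(1)] by simp
  define N where "N = ord ?g"
  have N: "N > 0" "?g [^] N = \<one>" using ord_pos[OF g] g by (simp_all add: N_def)
  define v where "v = (\<lambda>x. \<Sum>k<N. act (?g [^] k) b x)"
  have "act ?g v = (\<lambda>x. \<Sum>k<N. act (?g [^] Suc k) b x)"
  proof -
    have "act ?g v = (\<lambda>x. \<Sum>k<N. act ?g (act (?g [^] k) b) x)"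
      using act_sum[of ?g "\<lambda>_. 1" "\<lambda>k. act (?g [^] k) b" "{..<N}"] by (simp add: v_def)
    moreover have "act ?g (act (?g [^] k) b) = act (?g [^] Suc k) b" for k :: nat
      using g by (subst nat_pow_Suc2[OF g]) simp
    ultimately show ?thesis by simp
  qed
  \<comment> \<open>Shifting the summation index by one wraps around, because the
    \<open>N\<close>-th power is \<open>\<one>\<close>.\<close>
  also have "\<dots> = v"
  proof
    fix x
    have "(\<Sum>k<N. act (?g [^] Suc k) b x) + act (?g [^] (0::nat)) b x = (\<Sum>k<Suc N. act (?g [^] k) b x)"
      by (subst sum.lessThan_Suc_shift) simp
    also have "\<dots> = v x + b x" by (simp add: v_def N)
    finally show "(\<Sum>k<N. act (?g [^] Suc k) b x) = v x" by simp
  qed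
  finally have "act ?c v = v" using c by (metis act_inv1)
  moreover have "v x = 0" if "x \<notin> ?J" for x
  proof -
    have gp: "?g \<in> parab ?J" using parab_inv[OF J, of ?c] by (auto simp: parab_def)
    have "?g [^] k \<in> parab ?J" for k :: nat
      by (induction k) (use gp J in \<open>auto intro: parab_mult\<close>)
    then show ?thesis using parab_act_outside[OF J _ that] supp[OF that] by (simp add: v_def)
  qed
  ultimately have v0: "v = (\<lambda>x. 0)" using coxeter_element_no_fixed[OF dist xs] by blast
  \<comment> \<open>\<open>b\<close> is the term \<open>k = 0\<close> of a sum of nonnegative
    vectors that vanishes.\<close>
  have "b x = 0" for x
  proof -
    have "b x \<le> v x"
      using member_le_sum[of 0 "{..<N}" "\<lambda>k. act (?g [^] k) b x"] inv N by (simp add: v_def)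
    then show ?thesis using b(2)[of x] v0 by simp
  qed
  then show False using is_root_nonzero[OF b(1)] by auto
qed


section \<open>Saturated chains and the left weak order\<close>

fun sat_chain :: "'a \<Rightarrow> 'a list \<Rightarrow> bool" where
  "sat_chain u [] \<longleftrightarrow> True"
| "sat_chain u (t # ts) \<longleftrightarrow> len (u \<otimes> t) = len u + 1 \<and> sat_chain (u \<otimes> t) ts"

text \<open>The left weak order expressed through lengths; \<open>left_weak_le_iff\<close> relates
  it to suffixes of reduced words.\<close>

definition weak_le :: "'a \<Rightarrow> 'a \<Rightarrow> bool" where
  "weak_le u v \<longleftrightarrow> (\<exists>x\<in>carrier G. v = x \<otimes> u \<and> len v = len x + len u)"

text \<open>Relative to a parabolic subgroup, so that an induction on the rank can pass from
  \<open>J\<close> to \<open>J - {s}\<close>.\<close>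

definition has_greatest :: "'a set \<Rightarrow> 'a list \<Rightarrow> bool" where
  "has_greatest J ts \<longleftrightarrow> (\<exists>b\<in>parab J. sat_chain b ts \<and> (\<forall>u\<in>parab J. sat_chain u ts \<longrightarrow> weak_le u b))"

abbreviation conj_word :: "'a \<Rightarrow> 'a list \<Rightarrow> 'a list" where
  "conj_word s \<equiv> map (\<lambda>t. s \<otimes> t \<otimes> s)"

lemma refls_closed [simp]: "t \<in> refls \<Longrightarrow> t \<in> carrier G"
  by (rule reflection_square)

lemma lists_refls_carrier [simp]: "ts \<in> lists refls \<Longrightarrow> set ts \<subseteq> carrier G"
  by auto

lemma refls_conj: "t \<in> refls \<Longrightarrow> s \<in> S \<Longrightarrow> s \<otimes> t \<otimes> s \<in> refls"
  using pos_root_exists[of t] is_root_conj[of t _ s] is_root_refls by (metis S_closed S_inv)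

lemma conj_word_refls: "ts \<in> lists refls \<Longrightarrow> s \<in> S \<Longrightarrow> conj_word s ts \<in> lists refls"
  using refls_conj by auto

lemma wp_conj: "set ts \<subseteq> carrier G \<Longrightarrow> s \<in> S \<Longrightarrow> wp (conj_word s ts) = s \<otimes> wp ts \<otimes> s"
  using word_prod_conj[of ts s] by simp

lemma conj_eq_simple: "t \<in> carrier G \<Longrightarrow> s \<in> S \<Longrightarrow> s \<otimes> t \<otimes> s = s \<Longrightarrow> t = s"
proof -
  assume t: "t \<in> carrier G" and s: "s \<in> S" and e: "s \<otimes> t \<otimes> s = s"
  have "s \<otimes> t = s \<otimes> t \<otimes> s \<otimes> s" using t s by simp
  also have "\<dots> = \<one>" using e s by (simp del: S_cancel)
  finally have "s \<otimes> (s \<otimes> t) = s" using s by (simp del: S_cancel')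
  then show "t = s" using t s by simp
qed

lemma sat_chain_append:
  "set ts \<subseteq> carrier G \<Longrightarrow> set rs \<subseteq> carrier G \<Longrightarrow> u \<in> carrier G \<Longrightarrow>
    sat_chain u (ts @ rs) \<longleftrightarrow> sat_chain u ts \<and> sat_chain (u \<otimes> wp ts) rs"
  by (induction ts arbitrary: u) (auto simp: m_assoc)

lemma sat_chain_len:
  "set ts \<subseteq> carrier G \<Longrightarrow> u \<in> carrier G \<Longrightarrow> sat_chain u ts \<Longrightarrow> len (u \<otimes> wp ts) = len u + length ts"
  by (induction ts arbitrary: u) (auto simp: m_assoc[symmetric])

text \<open>A case of the lifting property. As \<open>t\<close> is not \<open>s\<close>, the
  positive root of \<open>t\<close> stays positive under \<open>s\<close>. If \<open>s\<close> were
  a descent of \<open>x t\<close>, then \<open>x t s\<close> would send that new root to a negative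
  one, making \<open>x s\<close> shorter than \<open>x t s\<close>, although the latter has the
  length of \<open>x\<close>.\<close>

lemma lifting:
  assumes x: "x \<in> carrier G" and t: "t \<in> refls" and s: "s \<in> S" and ne: "t \<noteq> s"
    and cover: "len (x \<otimes> t) = len x + 1" and asc: "len x < len (x \<otimes> s)"
  shows "len (x \<otimes> t) < len (x \<otimes> t \<otimes> s)"
proof (rule ccontr)
  assume *: "\<not> ?thesis"
  note tt = reflection_square[OF t]
  let ?y = "x \<otimes> t"
  have y: "?y \<in> carrier G" using x tt by simp
  have l: "len ?y = len (?y \<otimes> s) + 1" using len_descent[OF y s *] .
  obtain b where b: "is_root t b" "\<And>x. b x \<ge> 0" using pos_root_exists[OF t] by blast
  have sb: "is_root (s \<otimes> t \<otimes> s) (srefl s b)" using is_root_conj[OF b(1), of s] s by simp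
  have sb0: "srefl s b z \<ge> 0" for z
  proof (rule ccontr)
    assume "\<not> srefl s b z \<ge> 0"
    then have "\<And>x. srefl s b x \<le> 0" using is_root_sign[OF sb] by blast
    then show False using reflection_unique[OF b(1) s srefl_sign_change[OF b(2)]] ne by blast
  qed
  have xb: "act x b z \<ge> 0" for z using len_reflection_iff(1)[OF b x] cover by simp
  have "act (?y \<otimes> s) (srefl s b) z \<le> 0" for z
    using xb[of z] y s x tt act_reflection_root[OF b(1)] by (simp add: act_minus)
  then have "len (?y \<otimes> s \<otimes> (s \<otimes> t \<otimes> s)) < len (?y \<otimes> s)"
    using len_reflection_less[OF sb sb0] y s by simp
  moreover have "?y \<otimes> s \<otimes> (s \<otimes> t \<otimes> s) = x \<otimes> (t \<otimes> t) \<otimes> s"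
    using x tt(3) s by (simp add: m_assoc del: S_cancel)
  ultimately show False using tt x s l asc cover by simp
qed

text \<open>By \<open>lifting\<close> the ascent \<open>s\<close> persists along the whole chain, so
  multiplying every element by \<open>s\<close> on the right raises all lengths by one.\<close>

lemma sat_chain_conj:
  assumes "ts \<in> lists refls" "s \<in> S" "s \<notin> set ts" "u \<in> carrier G" "sat_chain u ts" "len u < len (u \<otimes> s)"
  shows "sat_chain (u \<otimes> s) (conj_word s ts)"
  using assms
proof (induction ts arbitrary: u rule: list.induct)
  case (Cons t ts)
  have t: "t \<in> refls" "t \<in> carrier G" "ts \<in> lists refls" "t \<noteq> s" using Cons.prems(1,3) by auto
  note u = Cons.prems(4) and s = Cons.prems(2)
  have c: "len (u \<otimes> t) = len u + 1" "sat_chain (u \<otimes> t) ts" using Cons.prems(5) by auto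
  have asc: "len (u \<otimes> t) < len (u \<otimes> t \<otimes> s)"
    using lifting[OF u t(1) s t(4) c(1) Cons.prems(6)] .
  have e: "u \<otimes> s \<otimes> (s \<otimes> t \<otimes> s) = u \<otimes> t \<otimes> s" using u t s by (simp add: m_assoc del: S_cancel)
  have "sat_chain (u \<otimes> t \<otimes> s) (conj_word s ts)"
    using Cons.IH[OF t(3) s _ _ c(2) asc] Cons.prems(3) u t by simp
  moreover have "len (u \<otimes> t \<otimes> s) = len (u \<otimes> s) + 1"
    using len_ascent[of "u \<otimes> t" s] len_ascent[of u s] asc Cons.prems(6) u t s c by simp
  ultimately show ?case using e by simp
qed simp

text \<open>\<open>lifting\<close> read backwards: an ascent \<open>s\<close> before a step would
  persist after it, so a descent at the end of the chain propagates back to its start, and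
  multiplying by \<open>s\<close> lowers all lengths by one.\<close>

lemma sat_chain_conj_down:
  assumes "ts \<in> lists refls" "s \<in> S" "s \<notin> set ts" "v \<in> carrier G" "sat_chain v (conj_word s ts)"
    "len (v \<otimes> wp (conj_word s ts) \<otimes> s) < len (v \<otimes> wp (conj_word s ts))"
  shows "len (v \<otimes> s) < len v \<and> sat_chain (v \<otimes> s) ts"
  using assms
proof (induction ts arbitrary: v rule: list.induct)
  case Nil
  then show ?case by simp
next
  case (Cons t ts)
  have t: "t \<in> refls" "t \<in> carrier G" "ts \<in> lists refls" "t \<noteq> s" using Cons.prems(1,3) by auto
  note v = Cons.prems(4) and s = Cons.prems(2)
  let ?r = "s \<otimes> t \<otimes> s"
  have r: "?r \<in> refls" "?r \<noteq> s" "?r \<in> carrier G"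
    using refls_conj[OF t(1) s] conj_eq_simple[OF t(2) s] t(4) refls_closed by blast+
  have c: "len (v \<otimes> ?r) = len v + 1" "sat_chain (v \<otimes> ?r) (conj_word s ts)" using Cons.prems(5) by auto
  have w: "wp (conj_word s ts) \<in> carrier G" using lists_refls_carrier[OF conj_word_refls[OF t(3) s]] by blast
  have "v \<otimes> wp (conj_word s (t # ts)) = v \<otimes> ?r \<otimes> wp (conj_word s ts)" using v r w t s by (simp add: m_assoc)
  then have ih: "len (v \<otimes> ?r \<otimes> s) < len (v \<otimes> ?r)" "sat_chain (v \<otimes> ?r \<otimes> s) ts"
    using Cons.IH[OF t(3) s _ _ c(2)] Cons.prems(3,6) v r by auto
  have d: "len (v \<otimes> s) < len v"
  proof (rule ccontr)
    assume "\<not> ?thesis"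
    then have "len v < len (v \<otimes> s)" using len_ascent[OF v s] by simp
    from lifting[OF v r(1) s r(2) c(1) this] show False using ih(1) by simp
  qed
  have e: "v \<otimes> ?r \<otimes> s = v \<otimes> s \<otimes> t" using v t s by (simp add: m_assoc)
  have "len (v \<otimes> s \<otimes> t) = len (v \<otimes> s) + 1"
    using len_descent[of "v \<otimes> ?r" s] len_descent[of v s] ih(1) d v r s c(1) unfolding e[symmetric] by simp
  then show ?case using d ih(2) e by simp
qed

lemma weak_le_cancel:
  assumes u: "u \<in> carrier G" and v: "v \<in> carrier G" and s: "s \<in> S"
    and "weak_le (u \<otimes> s) v" "len u < len (u \<otimes> s)" "len (v \<otimes> s) < len v"
  shows "weak_le u (v \<otimes> s)"
proof -
  obtain x where x: "x \<in> carrier G" "v = x \<otimes> (u \<otimes> s)" "len v = len x + len (u \<otimes> s)"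
    using assms(4) by (auto simp: weak_le_def)
  have "v \<otimes> s = x \<otimes> u" using x u s by (simp add: m_assoc)
  moreover have "len (v \<otimes> s) = len x + len u"
    using x(3) len_ascent[OF u s] len_descent[OF v s] assms(5,6) by simp
  ultimately show ?thesis using x(1) by (auto simp: weak_le_def)
qed

section \<open>Inductive construction of the greatest element\<close>

text \<open>The end of the chain is \<open>u s\<close> times \<open>wp xs\<close>, and
  \<open>wp xs\<close> can account for at most \<open>length xs\<close>, one less than the total
  rise.\<close>

lemma sat_chain_initial_ascent:
  assumes "u \<in> carrier G" "s \<in> S" "xs \<in> lists S" "ts \<in> lists refls" "sat_chain u ts"
    "length ts = Suc (length xs)" "wp ts = s \<otimes> wp xs"
  shows "len u < len (u \<otimes> s)"
proof -
  have w: "wp xs \<in> carrier G" using assms(3) by blast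
  have "len u + length ts = len (u \<otimes> s \<otimes> wp xs)"
    using sat_chain_len[of ts u] assms w by (simp add: m_assoc)
  also have "\<dots> \<le> len (u \<otimes> s) + length xs"
    using len_mult_le[of "u \<otimes> s" "wp xs"] word_length_le[OF assms(3) refl] assms w by simp
  finally show ?thesis using assms(6) by simp
qed

text \<open>The first letter of the Coxeter word forces \<open>s\<close> to be an ascent of each
  \<open>u\<close>. At the end of the conjugated chain from \<open>b\<close>, removing the last
  letter \<open>s\<close> leaves \<open>b\<close> times \<open>wp xs\<close>, which is too short, so
  \<open>s\<close> is a descent there and the chain can be pulled back to
  \<open>b s\<close>.\<close>

lemma has_greatest_rotate:
  assumes s: "s \<in> S" and xs: "xs \<in> lists S" and ts: "ts \<in> lists refls" and sn: "s \<notin> set ts"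
    and l: "length ts = Suc (length xs)" and eq: "wp ts = s \<otimes> wp xs"
    and g: "has_greatest (insert s (set xs)) (conj_word s ts)"
  shows "has_greatest (insert s (set xs)) ts"
proof -
  let ?J = "insert s (set xs)"
  have J: "?J \<subseteq> S" using s xs by auto
  have w: "wp xs \<in> carrier G" using xs by blast
  have sJ: "s \<in> parab ?J" using parab_simple[OF J] by simp
  obtain b where b: "b \<in> parab ?J" "sat_chain b (conj_word s ts)"
    "\<And>v. v \<in> parab ?J \<Longrightarrow> sat_chain v (conj_word s ts) \<Longrightarrow> weak_le v b"
    using g by (auto simp: has_greatest_def)
  have bc: "b \<in> carrier G" using b parab_closed[OF J] by blast
  have cs: "conj_word s ts \<in> lists refls" using conj_word_refls[OF ts s] .
  have wc: "wp (conj_word s ts) = wp xs \<otimes> s" using wp_conj[of ts s] ts s w eq by simp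
  have "len (b \<otimes> wp (conj_word s ts) \<otimes> s) \<le> len b + length xs"
    unfolding wc using len_mult_le[OF bc w] word_length_le[OF xs refl] s bc w by (simp add: m_assoc)
  also have "\<dots> < len (b \<otimes> wp (conj_word s ts))" using sat_chain_len[OF lists_refls_carrier[OF cs] bc b(2)] l by simp
  finally have d: "len (b \<otimes> s) < len b" "sat_chain (b \<otimes> s) ts"
    using sat_chain_conj_down[OF ts s sn bc b(2)] by auto
  have "weak_le u (b \<otimes> s)" if u: "u \<in> parab ?J" "sat_chain u ts" for u
  proof -
    have uc: "u \<in> carrier G" using u parab_closed[OF J] by blast
    have asc: "len u < len (u \<otimes> s)" using sat_chain_initial_ascent[OF uc s xs ts u(2) l eq] .
    have "weak_le (u \<otimes> s) b" using b(3) parab_mult[OF J u(1) sJ] sat_chain_conj[OF ts s sn uc u(2) asc] by blast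
    then show ?thesis using weak_le_cancel[OF uc bc s] asc d(1) by blast
  qed
  then show ?thesis unfolding has_greatest_def using d(2) parab_mult[OF J b(1) sJ] by blast
qed

lemma sat_chain_coset:
  assumes J: "J \<subseteq> S" and x: "x \<in> carrier G" and add: "\<And>z. z \<in> parab J \<Longrightarrow> len (x \<otimes> z) = len x + len z"
    and "z \<in> parab J" "set ts \<subseteq> parab J"
  shows "sat_chain (x \<otimes> z) ts \<longleftrightarrow> sat_chain z ts"
  using assms(4,5)
proof (induction ts arbitrary: z)
  case (Cons t ts)
  have zt: "z \<otimes> t \<in> parab J" using parab_mult[OF J] Cons.prems by auto
  have c: "z \<in> carrier G" "t \<in> carrier G" using Cons.prems parab_closed[OF J] by auto
  then show ?case using Cons.IH[OF zt] Cons.prems add[OF zt] add[OF Cons.prems(1)] x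
    by (simp add: m_assoc)
qed simp

lemma has_greatest_extend:
  assumes s: "s \<in> S" and xs: "xs \<in> lists S" and sxs: "s \<notin> set xs"
    and ts: "P @ s # Q \<in> lists refls" and sn: "s \<notin> set P"
    and l: "length (P @ s # Q) = Suc (length xs)" and eq: "wp (P @ s # Q) = s \<otimes> wp xs"
    and sub: "set (conj_word s P @ Q) \<subseteq> parab (set xs)"
    and g: "has_greatest (set xs) (conj_word s P @ Q)"
  shows "has_greatest (insert s (set xs)) (P @ s # Q)"
proof -
  let ?I = "set xs" and ?J = "insert s (set xs)" and ?R = "conj_word s P @ Q"
  have I: "?I \<subseteq> S" and J: "?J \<subseteq> S" using s xs by auto
  have IJ: "parab ?I \<subseteq> parab ?J" by (rule parab_mono) auto
  have sJ: "s \<in> parab ?J" using parab_simple[OF J] by simp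
  have P: "P \<in> lists refls" and Q: "Q \<in> lists refls" using ts by auto
  have Pc: "set P \<subseteq> carrier G" "set Q \<subseteq> carrier G" using P Q by auto
  have cP: "set (conj_word s P) \<subseteq> carrier G" using lists_refls_carrier[OF conj_word_refls[OF P s]] .
  have wP: "wp P \<in> carrier G" using Pc by blast
  have wcP: "wp (conj_word s P) = s \<otimes> wp P \<otimes> s" using wp_conj Pc s by blast
  obtain wJ where wJ: "wJ \<in> parab ?J" "\<And>y. y \<in> parab ?J \<Longrightarrow> len (wJ \<otimes> y) + len y = len wJ"
    using longest_exists[OF J] by blast
  obtain wI where wI: "wI \<in> parab ?I" "\<And>y. y \<in> parab ?I \<Longrightarrow> len (wI \<otimes> y) + len y = len wI"
    using longest_exists[OF I] by blast
  have wc: "wJ \<in> carrier G" "wI \<in> carrier G" using wJ wI parab_closed J I by blast+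
  \<comment> \<open>The longest among the minimal representatives of the cosets of
    \<open>parab ?I\<close> in \<open>parab ?J\<close>.\<close>
  define d where "d = wJ \<otimes> wI"
  have dc: "d \<in> carrier G" and dJ: "d \<in> parab ?J"
    using wc wJ(1) wI(1) IJ parab_mult[OF J] by (auto simp: d_def)
  have dz: "len (d \<otimes> z) + len wI = len wJ + len z" if "z \<in> parab ?I" for z
  proof -
    have "z \<in> carrier G" using that parab_closed[OF I] by blast
    then have "len (d \<otimes> z) + len (wI \<otimes> z) = len wJ"
      using wJ(2)[of "wI \<otimes> z"] parab_mult[OF I wI(1) that] IJ wc by (auto simp: d_def m_assoc)
    then show ?thesis using wI(2)[OF that] by simp
  qed
  have dadd: "len (d \<otimes> z) = len d + len z" if "z \<in> parab ?I" for z
    using dz[OF that] dz[of \<one>] dc by simp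
  \<comment> \<open>\<open>s\<close> is an ascent throughout \<open>parab ?I\<close>, and
    \<open>wJ\<close> reverses lengths.\<close>
  have dzs: "len (d \<otimes> z \<otimes> s) < len (d \<otimes> z)" if z: "z \<in> parab ?I" for z
  proof -
    have zc: "z \<in> carrier G" using z parab_closed[OF I] by blast
    have wz: "wI \<otimes> z \<in> parab ?I" using parab_mult[OF I wI(1) z] .
    have "len (wJ \<otimes> (wI \<otimes> z)) + len (wI \<otimes> z) = len wJ" using wJ(2) wz IJ by blast
    moreover have "len (wJ \<otimes> (wI \<otimes> z \<otimes> s)) + len (wI \<otimes> z \<otimes> s) = len wJ"
      using wJ(2) parab_mult[OF J _ sJ] wz IJ by blast
    moreover have "len (wI \<otimes> z \<otimes> s) = len (wI \<otimes> z) + 1" using len_outside[OF I wz s sxs] .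
    ultimately show ?thesis using wc zc s by (simp add: d_def m_assoc)
  qed
  obtain b where b: "b \<in> parab ?I" "sat_chain b ?R" "\<And>v. v \<in> parab ?I \<Longrightarrow> sat_chain v ?R \<Longrightarrow> weak_le v b"
    using g by (auto simp: has_greatest_def)
  have bc: "b \<in> carrier G" using b parab_closed[OF I] by blast
  let ?v = "d \<otimes> b"
  have vc: "?v \<in> carrier G" using dc bc by simp
  have vR: "sat_chain ?v ?R" using sat_chain_coset[OF I dc dadd b(1) sub] b(2) by simp
  then have vP: "sat_chain ?v (conj_word s P)" and vQ: "sat_chain (?v \<otimes> wp (conj_word s P)) Q"
    using sat_chain_append[OF cP Pc(2) vc] by auto
  have wcPI: "wp (conj_word s P) \<in> parab ?I"
  proof -
    have "set ys \<subseteq> parab ?I \<Longrightarrow> wp ys \<in> parab ?I" for ys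
      by (induction ys) (auto intro: parab_mult[OF I])
    then show ?thesis using sub by simp
  qed
  have cPc: "wp (conj_word s P) \<in> carrier G" using cP by blast
  have vend: "len (?v \<otimes> wp (conj_word s P) \<otimes> s) < len (?v \<otimes> wp (conj_word s P))"
    using dzs[OF parab_mult[OF I b(1) wcPI]] dc bc cPc by (simp add: m_assoc)
  have dv: "len (?v \<otimes> s) < len ?v" and uP: "sat_chain (?v \<otimes> s) P"
    using sat_chain_conj_down[OF P s sn vc vP vend] by auto
  let ?u = "?v \<otimes> s"
  have uc: "?u \<in> carrier G" using vc s by simp
  have e1: "?u \<otimes> wp P = ?v \<otimes> wp (conj_word s P) \<otimes> s" unfolding wcP using vc s wP by (simp add: m_assoc)
  have e2: "?u \<otimes> wp P \<otimes> s = ?v \<otimes> wp (conj_word s P)" unfolding e1 using vc s cPc by simp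
  have "len (?u \<otimes> wp P \<otimes> s) = len (?u \<otimes> wp P) + 1"
    unfolding e2 unfolding e1 using len_descent[of "?v \<otimes> wp (conj_word s P)" s] vend vc cPc s by simp
  then have up_u: "sat_chain ?u (P @ s # Q)"
    using sat_chain_append[OF Pc(1) _ uc, of "s # Q"] Pc s uP vQ e2 by simp
  have uJ: "?u \<in> parab ?J" using parab_mult[OF J parab_mult[OF J dJ] sJ] b(1) IJ by blast
  have "weak_le u ?u" if u: "u \<in> parab ?J" "sat_chain u (P @ s # Q)" for u
  proof -
    have uc: "u \<in> carrier G" using u parab_closed[OF J] by blast
    have asc: "len u < len (u \<otimes> s)" using sat_chain_initial_ascent[OF uc s xs ts u(2) l eq] .
    have uP: "sat_chain u P" and uQ: "sat_chain (u \<otimes> wp P \<otimes> s) Q"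
      using u(2) sat_chain_append[OF Pc(1) _ uc, of "s # Q"] Pc s by auto
    have "sat_chain (u \<otimes> s) (conj_word s P)" using sat_chain_conj[OF P s sn uc uP asc] .
    moreover have "u \<otimes> s \<otimes> wp (conj_word s P) = u \<otimes> wp P \<otimes> s"
      unfolding wcP using uc s wP by (simp add: m_assoc)
    ultimately have uR: "sat_chain (u \<otimes> s) ?R"
      using sat_chain_append[OF cP Pc(2), of "u \<otimes> s"] uc s uQ by simp
    have us: "u \<otimes> s \<in> carrier G" "u \<otimes> s \<in> parab ?J" using uc s parab_mult[OF J u(1) sJ] by auto
    \<comment> \<open>Only the factor \<open>z\<close> in \<open>parab ?I\<close> feels the chain
      condition, so the smaller case bounds \<open>z\<close> by \<open>b\<close>, while any minimal
      representative \<open>x\<close> is allowed.\<close>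
    obtain x z where xz: "x \<in> carrier G" "z \<in> parab ?I" "u \<otimes> s = x \<otimes> z"
      "\<And>j. j \<in> ?I \<Longrightarrow> len x < len (x \<otimes> j)"
      using coset_decomposition[OF I us(1)] by blast
    have xadd: "len (x \<otimes> z) = len x + len z" if "z \<in> parab ?I" for z
      using len_coset[OF I that xz(1,4)] .
    have zc: "z \<in> carrier G" using xz parab_closed[OF I] by blast
    have "sat_chain z ?R" using sat_chain_coset[OF I xz(1) xadd xz(2) sub] uR xz(3) by simp
    then obtain y where y: "y \<in> carrier G" "b = y \<otimes> z" "len b = len y + len z"
      using b(3)[OF xz(2)] by (auto simp: weak_le_def)
    have "y = b \<otimes> inv z" using y zc by (simp add: m_assoc)
    then have yI: "y \<in> parab ?I" using parab_mult[OF I b(1) parab_inv[OF I xz(2)]] by simp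
    have "x = u \<otimes> s \<otimes> inv z" using xz zc by (simp add: m_assoc)
    then have xJ: "x \<in> parab ?J" using parab_mult[OF J us(2)] parab_inv[OF I xz(2)] IJ by auto
    \<comment> \<open>Chosen so that \<open>wJ\<close> times \<open>?h\<close> is the left factor
      taking \<open>u s\<close> to \<open>d b\<close>; the lengths then add up by the reversal
      formulas for \<open>wJ\<close> and \<open>wI\<close>.\<close>
    let ?h = "wI \<otimes> y \<otimes> inv x"
    have wy: "wI \<otimes> y \<in> parab ?I" using parab_mult[OF I wI(1) yI] .
    have wyc: "wI \<otimes> y \<in> carrier G" using wc y by simp
    have hJ: "?h \<in> parab ?J" using wy IJ parab_mult[OF J _ parab_inv[OF J xJ]] by blast
    have "len ?h = len (inv ?h)" using wyc xz(1) by simp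
    also have "inv ?h = x \<otimes> inv (wI \<otimes> y)" using wyc xz(1) by (simp add: inv_mult_group del: inv_mult_group[of wI])
    also have "len \<dots> = len x + len (wI \<otimes> y)" using xadd[OF parab_inv[OF I wy]] wyc by simp
    finally have lh: "len ?h = len x + len (wI \<otimes> y)" .
    have "?v = (wJ \<otimes> ?h) \<otimes> (u \<otimes> s)"
    proof -
      have "(wJ \<otimes> ?h) \<otimes> (x \<otimes> z) = wJ \<otimes> wI \<otimes> y \<otimes> (inv x \<otimes> x) \<otimes> z"
        using wc y(1) xz(1) zc m_assoc[of "inv x" x z] by (simp add: m_assoc)
      then show ?thesis using xz y zc wc by (simp add: d_def m_assoc)
    qed
    moreover have "len ?v = len (wJ \<otimes> ?h) + len (u \<otimes> s)"
      using wJ(2)[OF hJ] lh wI(2)[OF yI] dz[OF b(1)] y(3) xadd[OF xz(2)] xz(3) by simp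
    moreover have "wJ \<otimes> ?h \<in> carrier G" using wc wyc xz(1) by simp
    ultimately have "weak_le (u \<otimes> s) ?v" unfolding weak_le_def by blast
    then show ?thesis using weak_le_cancel[OF uc vc s _ asc dv] by blast
  qed
  then show ?thesis unfolding has_greatest_def using up_u uJ by blast
qed

theorem greatest_exists:
  assumes "distinct xs" "xs \<in> lists S" "ts \<in> lists refls" "length ts = length xs" "wp ts = wp xs"
  shows "has_greatest (set xs) ts"
  using assms
proof (induction "length xs" arbitrary: xs ts)
  case 0
  then have "xs = []" "ts = []" by auto
  moreover have "parab {} = {\<one>}" by (auto simp: parab_def)
  ultimately show ?case by (auto simp: has_greatest_def weak_le_def intro!: bexI[of _ \<one>])
next
  case (Suc m)
  \<comment> \<open>Inner induction on the number of rotations. The word, the factors and the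
    tracked factor \<open>t\<close> all vary, with the length fixed, so the outer hypothesis stays
    applicable.\<close>
  have rot: "has_greatest (set xs) ts"
    if "m = length xs - 1" "distinct xs" "xs \<in> lists S" "xs \<noteq> []" "ts \<in> lists refls" "length ts = length xs"
      "wp ts = wp xs" "t \<in> set ts" "hits n xs t" for n xs ts t
    using that
  proof (induction n arbitrary: xs ts t rule: less_induct)
    case (less n)
    note m = less.prems(1) and d = less.prems(2) and xs = less.prems(3) and ne = less.prems(4)
      and ts = less.prems(5) and l = less.prems(6) and eq = less.prems(7) and t = less.prems(8,9)
    obtain s ys where sys: "xs = s # ys" using ne by (cases xs) auto
    have s: "s \<in> S" "ys \<in> lists S" "s \<notin> set ys" "distinct ys" using d xs sys by auto
    have w: "wp ys \<in> carrier G" using s by blast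
    have set: "set xs = insert s (set ys)" using sys by simp
    have l': "length ts = Suc (length ys)" and eq': "wp ts = s \<otimes> wp ys" using l eq sys by auto
    show ?case
    proof (cases "s \<in> set ts")
      case True
      \<comment> \<open>Splitting at the first occurrence keeps \<open>s\<close> out of
        \<open>P\<close>, as the chain conjugation lemmas require; moving \<open>s\<close> to the
        front conjugates \<open>P\<close>.\<close>
      then obtain P Q where PQ: "ts = P @ s # Q" "s \<notin> set P" using split_list_first by metis
      have P: "P \<in> lists refls" "Q \<in> lists refls" using ts PQ by auto
      have pc: "set P \<subseteq> carrier G" "set Q \<subseteq> carrier G" using P by auto
      then have wc: "wp P \<in> carrier G" "wp Q \<in> carrier G" by blast+
      have R: "conj_word s P @ Q \<in> lists refls" using conj_word_refls[OF P(1) s(1)] P(2) by auto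
      have lR: "length (conj_word s P @ Q) = length ys" using l' PQ by simp
      have "wp (conj_word s P @ Q) = s \<otimes> (wp P \<otimes> (s \<otimes> wp Q))"
        using word_prod_append[OF lists_refls_carrier[OF conj_word_refls[OF P(1) s(1)]] pc(2)] wp_conj[OF pc(1) s(1)] wc s
        by (simp add: m_assoc)
      also have "\<dots> = s \<otimes> wp ts" unfolding PQ(1) using pc s by (simp add: word_prod_append)
      also have "\<dots> = wp ys" using eq' s w by simp
      finally have wR: "wp (conj_word s P @ Q) = wp ys" .
      have g: "has_greatest (set ys) (conj_word s P @ Q)"
        using Suc.hyps(1)[OF _ s(4,2) R lR wR] m sys by simp
      have sub: "set (conj_word s P @ Q) \<subseteq> parab (set ys)"
        using coxeter_factors_in_parab[OF s(4,2) R _ wR] lR by simp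
      show ?thesis unfolding set PQ(1)
        using has_greatest_extend[OF s(1,2,3) _ PQ(2) _ _ sub g] ts l' eq' unfolding PQ(1) by blast
    next
      case False
      \<comment> \<open>With no rotations left, the tracked factor would be \<open>s\<close> itself,
        which is not among the factors.\<close>
      then obtain n' where n': "n = Suc n'" using t sys by (cases n) auto
      have "hits n' (ys @ [s]) (s \<otimes> t \<otimes> s)" using t(2) n' sys by simp
      moreover have "s \<otimes> t \<otimes> s \<in> set (conj_word s ts)" using t(1) by simp
      moreover have "wp (conj_word s ts) = wp (ys @ [s])"
        using wp_conj[of ts s] ts s eq' w by (simp add: word_prod_append)
      ultimately have "has_greatest (set (ys @ [s])) (conj_word s ts)"
        using m sys s l' conj_word_refls[OF ts s(1)] by (intro less.IH[of n' "ys @ [s]" "conj_word s ts" "s \<otimes> t \<otimes> s"]) (auto simp: n')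
      then show ?thesis unfolding set using has_greatest_rotate[OF s(1,2) ts False l' eq'] by simp
    qed
  qed
  obtain t ts' where t: "ts = t # ts'" using Suc.hyps(2) Suc.prems(4) by (cases ts) auto
  have "set ts \<subseteq> parab (set xs)"
    using coxeter_factors_in_parab[OF Suc.prems(1-3) _ Suc.prems(5)] Suc.prems(4) by simp
  then have "t \<in> refls" "t \<in> parab (set xs)" using t Suc.prems(3) by auto
  then obtain n where "hits n xs t" using hits_exists[OF Suc.prems(1,2)] by blast
  then show ?case using rot[of xs ts t n] Suc.prems Suc.hyps(2) t by fastforce
qed


section \<open>Left weak order through lengths and inversions\<close>

lemma left_weak_le_iff:
  assumes "u \<in> carrier G"
  shows "left_weak_le G S u v \<longleftrightarrow> weak_le u v"
proof
  assume "left_weak_le G S u v"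
  then obtain xs ys where r: "reduced_word G S xs u" "reduced_word G S (ys @ xs) v"
    unfolding left_weak_le_def suffix_def by blast
  then have xs: "xs \<in> lists S" "wp xs = u" "length xs = len u"
    and yxs: "ys \<in> lists S" "wp (ys @ xs) = v" "length ys + length xs = len v"
    by (auto simp: reduced_word_def)
  have v: "v = wp ys \<otimes> u" using xs yxs by (simp add: word_prod_append)
  have "len v \<le> len (wp ys) + len u"
    unfolding v using len_mult_le[of "wp ys" u] yxs(1) assms by blast
  moreover have "len (wp ys) \<le> length ys" using word_length_le[OF yxs(1) refl] .
  ultimately have "len v = len (wp ys) + len u" using xs yxs by simp
  then show "weak_le u v" unfolding weak_le_def using v yxs(1) by blast
next
  assume "weak_le u v"
  then obtain x where x: "x \<in> carrier G" "v = x \<otimes> u" "len v = len x + len u"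
    by (auto simp: weak_le_def)
  obtain xs where xs: "xs \<in> lists S" "wp xs = u" "length xs = len u"
    using reduced_exists[OF assms] .
  obtain ys where ys: "ys \<in> lists S" "wp ys = x" "length ys = len x"
    using reduced_exists[OF x(1)] .
  have "reduced_word G S xs u" "reduced_word G S (ys @ xs) v"
    using xs ys x by (auto simp: reduced_word_def word_prod_append)
  then show "left_weak_le G S u v" unfolding left_weak_le_def suffix_def by blast
qed

text \<open>Inversions are inherited upward in the left weak order.\<close>

lemma weak_le_inversion:
  assumes "weak_le u v" "u \<in> carrier G" "t \<in> carrier G" "len (u \<otimes> t) < len u"
  shows "len (v \<otimes> t) < len v"
proof -
  obtain x where x: "x \<in> carrier G" "v = x \<otimes> u" "len v = len x + len u"
    using assms(1) by (auto simp: weak_le_def)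
  have "len (v \<otimes> t) \<le> len x + len (u \<otimes> t)"
    using len_mult_le[of x "u \<otimes> t"] x assms by (simp add: m_assoc)
  then show ?thesis using assms(4) x(3) by simp
qed

text \<open>The step is an ascent from \<open>u p\<close> exactly when \<open>u\<close> keeps the
  root \<open>?\<gamma>\<close> nonnegative. If \<open>?\<gamma>\<close> is positive, this says that
  its reflection is no inversion, which passes down from \<open>b\<close>; if negative, that it is
  an inversion, which passes up from \<open>a\<close>.\<close>

lemma weak_le_convex_step:
  assumes c: "a \<in> carrier G" "w \<in> carrier G" "b \<in> carrier G" "p \<in> carrier G" and t: "t \<in> refls"
    and le: "weak_le a w" "weak_le w b"
    and asc: "len (a \<otimes> p) < len (a \<otimes> p \<otimes> t)" "len (b \<otimes> p) < len (b \<otimes> p \<otimes> t)"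
  shows "len (w \<otimes> p) < len (w \<otimes> p \<otimes> t)"
proof -
  obtain \<beta> where \<beta>: "is_root t \<beta>" "\<And>x. \<beta> x \<ge> 0" using pos_root_exists[OF t] by blast
  let ?r = "p \<otimes> t \<otimes> inv p" and ?\<gamma> = "act p \<beta>"
  have \<gamma>: "is_root ?r ?\<gamma>" using is_root_conj[OF \<beta>(1) c(4)] .
  have rc: "?r \<in> carrier G" using is_root_closed[OF \<gamma>] .
  have asc_iff: "len (u \<otimes> p) < len (u \<otimes> p \<otimes> t) \<longleftrightarrow> (\<forall>x. act u ?\<gamma> x \<ge> 0)" if "u \<in> carrier G" for u
    using len_reflection_iff(1)[OF \<beta>, of "u \<otimes> p"] that c(4) by simp
  show ?thesis
  proof (cases "\<forall>x. ?\<gamma> x \<ge> 0")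
    case True
    then have pos: "\<And>x. ?\<gamma> x \<ge> 0" by blast
    note iff = len_reflection_iff[OF \<gamma> pos]
    have "len b < len (b \<otimes> ?r)" using asc(2) asc_iff[OF c(3)] iff(1)[OF c(3)] by simp
    then have "\<not> len (w \<otimes> ?r) < len w" using weak_le_inversion[OF le(2) c(2) rc] by auto
    then show ?thesis using iff[OF c(2)] asc_iff[OF c(2)] root_image_sign[OF \<gamma> c(2)] by blast
  next
    case False
    then have pos: "\<And>x. - ?\<gamma> x \<ge> 0" using is_root_sign[OF \<gamma>] by auto
    note iff = len_reflection_iff[OF is_root_minus[OF \<gamma>] pos, unfolded act_minus]
    have "len (a \<otimes> ?r) < len a" using asc(1) asc_iff[OF c(1)] iff(2)[OF c(1)] by simp
    then have "len (w \<otimes> ?r) < len w" using weak_le_inversion[OF le(1) c(1) rc] by auto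
    then show ?thesis using iff(2)[OF c(2)] asc_iff[OF c(2)] by simp
  qed
qed

lemma sat_chain_iff:
  assumes "set ts \<subseteq> carrier G" "u \<in> carrier G"
  shows "sat_chain u ts \<longleftrightarrow>
    (\<forall>i<length ts. len (u \<otimes> wp (take (Suc i) ts)) = len (u \<otimes> wp (take i ts)) + 1)"
  using assms
proof (induction ts arbitrary: u)
  case (Cons t ts)
  have tk: "set (take i ts) \<subseteq> carrier G" for i using Cons.prems set_take_subset[of i ts] by auto
  have e: "u \<otimes> t \<otimes> wp (take i ts) = u \<otimes> wp (take (Suc i) (t # ts))" for i
    using Cons.prems tk by (simp add: m_assoc word_prod_closed)
  have "sat_chain (u \<otimes> t) ts \<longleftrightarrow>
      (\<forall>i<length ts. len (u \<otimes> wp (take (Suc (Suc i)) (t # ts))) = len (u \<otimes> wp (take (Suc i) (t # ts))) + 1)"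
    using Cons.IH[of "u \<otimes> t"] Cons.prems unfolding e by simp
  moreover have "len (u \<otimes> t) = len u + 1 \<longleftrightarrow>
      len (u \<otimes> wp (take (Suc 0) (t # ts))) = len (u \<otimes> wp (take 0 (t # ts))) + 1"
    using Cons.prems by simp
  ultimately show ?case
    by (simp only: sat_chain.simps length_Cons All_less_Suc2)
qed simp

end

text \<open>The \<open>n\<close> strict increases already use up the whole allowance
  \<open>n\<close>, so none can exceed one.\<close>

lemma increasing_sequence_tight:
  fixes f :: "nat \<Rightarrow> nat"
  assumes inc: "\<And>i. i < n \<Longrightarrow> f i < f (Suc i)" and bound: "f n \<le> f 0 + n" and i: "i < n"
  shows "f (Suc i) = f i + 1"
proof -
  have lower: "f 0 + j \<le> f j" if "j \<le> n" for j
    using that by (induction j) (use inc in \<open>auto simp: Suc_le_eq intro: le_less_trans\<close>)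
  have upper: "f (n - k) + k \<le> f n" if "k \<le> n" for k
    using that
  proof (induction k)
    case (Suc k)
    then have "f (n - Suc k) < f (Suc (n - Suc k))" using inc[of "n - Suc k"] by simp
    moreover have "Suc (n - Suc k) = n - k" using Suc.prems by simp
    ultimately show ?case using Suc by simp
  qed simp
  have "f (Suc i) + (n - Suc i) \<le> f 0 + n" using upper[of "n - Suc i"] bound i by simp
  moreover have "f 0 + i \<le> f i" using lower[of i] i by simp
  ultimately show ?thesis using inc[OF i] i by linarith
qed

section \<open>Convexity, duality and the interval of saturated chains\<close>

context finite_coxeter_system
begin

text \<open>The convex step gives only strict increases; the bound on the length of the Coxeter
  element makes each of them exactly one.\<close>

lemma sat_chain_convex:
  assumes xs: "xs \<in> lists S" and ts: "ts \<in> lists refls" "length ts = length xs" "wp ts = wp xs"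
    and c: "a \<in> carrier G" "w \<in> carrier G" "b \<in> carrier G" and le: "weak_le a w" "weak_le w b"
    and ab: "sat_chain a ts" "sat_chain b ts"
  shows "sat_chain w ts"
proof -
  have tc: "set ts \<subseteq> carrier G" using ts by simp
  have tk: "wp (take i ts) \<in> carrier G" for i
    using tc set_take_subset[of i ts] by (intro word_prod_closed) auto
  have snoc: "wp (take (Suc i) ts) = wp (take i ts) \<otimes> ts ! i" if "i < length ts" for i
  proof -
    have "set (take i ts) \<subseteq> carrier G" "ts ! i \<in> carrier G"
      using tc that set_take_subset[of i ts] nth_mem[OF that] by auto
    then show ?thesis using that by (simp add: take_Suc_conv_app_nth word_prod_append)
  qed
  let ?f = "\<lambda>i. len (w \<otimes> wp (take i ts))"
  have inc: "?f i < ?f (Suc i)" if i: "i < length ts" for i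
  proof -
    have t: "ts ! i \<in> refls" using ts(1) i by auto
    have "len (u \<otimes> wp (take i ts)) < len (u \<otimes> wp (take i ts) \<otimes> ts ! i)"
      if "sat_chain u ts" "u \<in> carrier G" for u
    proof -
      have "len (u \<otimes> wp (take (Suc i) ts)) = len (u \<otimes> wp (take i ts)) + 1"
        using sat_chain_iff[OF tc that(2)] that(1) i by blast
      then show ?thesis using that(2) tk[of i] t unfolding snoc[OF i] by (simp add: m_assoc)
    qed
    then have "len (w \<otimes> wp (take i ts)) < len (w \<otimes> wp (take i ts) \<otimes> ts ! i)"
      using weak_le_convex_step[OF c tk t le] ab c by blast
    then show ?thesis unfolding snoc[OF i] using c tk t by (simp add: m_assoc)
  qed
  have "?f (length ts) \<le> ?f 0 + length ts"
    using len_mult_le[of w "wp xs"] word_length_le[OF xs refl] xs c ts by simp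
  then show ?thesis unfolding sat_chain_iff[OF tc c(2)]
    using increasing_sequence_tight[of "length ts" ?f] inc by blast
qed

text \<open>Left multiplication by the longest element reverses the chain from \<open>u\<close> to \<open>u c\<close>.\<close>

lemma sat_chain_dual:
  assumes w0: "w0 \<in> carrier G" "\<And>y. y \<in> carrier G \<Longrightarrow> len (w0 \<otimes> y) + len y = len w0"
    and "ts \<in> lists refls" "u \<in> carrier G" "sat_chain u ts"
  shows "sat_chain (w0 \<otimes> (u \<otimes> wp ts)) (rev ts)"
  using assms(3-)
proof (induction ts arbitrary: u rule: list.induct)
  case (Cons t ts)
  have t: "t \<in> refls" "t \<in> carrier G" "ts \<in> lists refls" "set ts \<subseteq> carrier G" using Cons.prems(1) by auto
  note tt = reflection_square[OF t(1)]
  have w: "wp ts \<in> carrier G" using t by blast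
  note u = Cons.prems(2)
  have l: "len (u \<otimes> t) = len u + 1" "sat_chain (u \<otimes> t) ts" using Cons.prems(3) by auto
  let ?v = "w0 \<otimes> (u \<otimes> wp (t # ts))"
  have v: "?v = w0 \<otimes> (u \<otimes> t \<otimes> wp ts)" "?v \<in> carrier G" using w0 u t w by (simp_all add: m_assoc)
  have "sat_chain ?v (rev ts)" unfolding v(1) using Cons.IH[OF t(3) _ l(2)] u t by simp
  moreover have "sat_chain (?v \<otimes> wp (rev ts)) [t]"
  proof -
    have "wp (rev ts) = inv (wp ts)"
      by (rule word_prod_rev[OF t(4)]) (use t(3) reflection_square(2) in auto)
    then have "?v \<otimes> wp (rev ts) = w0 \<otimes> (u \<otimes> t)" using w0 u t w v(1) by (simp add: m_assoc)
    moreover have "w0 \<otimes> (u \<otimes> t) \<otimes> t = w0 \<otimes> u" using w0 u tt by (simp add: m_assoc)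
    ultimately show ?thesis using w0(2)[of "u \<otimes> t"] w0(2)[of u] u t l by simp
  qed
  ultimately show ?case using sat_chain_append[of "rev ts" "[t]" ?v] v t by simp
qed simp

theorem concordance_interval:
  assumes dist: "distinct xs" and xs: "set xs = S"
    and ts: "ts \<in> lists refls" "length ts = length xs" "wp ts = wp xs"
  obtains a b where "a \<in> carrier G" "b \<in> carrier G" "sat_chain a ts"
    "\<And>u. u \<in> carrier G \<Longrightarrow> sat_chain u ts \<longleftrightarrow> weak_le a u \<and> weak_le u b"
proof -
  have xsl: "xs \<in> lists S" using xs by auto
  have tc: "set ts \<subseteq> carrier G" using ts by simp
  let ?c = "wp ts"
  have c: "?c \<in> carrier G" using tc by blast
  obtain b where b: "b \<in> carrier G" "sat_chain b ts" "\<And>u. u \<in> carrier G \<Longrightarrow> sat_chain u ts \<Longrightarrow> weak_le u b"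
    using greatest_exists[OF dist xsl ts] by (auto simp: has_greatest_def xs parab_full)
  have rts: "rev ts \<in> lists refls" using ts by auto
  have rc: "wp (rev ts) = inv ?c"
    by (rule word_prod_rev[OF tc]) (use ts(1) reflection_square(2) in auto)
  have rx: "wp (rev xs) = inv (wp xs)"
    by (rule word_prod_rev) (use xs in auto)
  \<comment> \<open>The reversed word is again a Coxeter word, for the inverse element, and the
    reversed factors multiply to that inverse.\<close>
  have "has_greatest (set (rev xs)) (rev ts)"
    by (rule greatest_exists) (use dist xsl rts ts rc rx in auto)
  then obtain b' where b': "b' \<in> carrier G" "sat_chain b' (rev ts)"
    "\<And>u. u \<in> carrier G \<Longrightarrow> sat_chain u (rev ts) \<Longrightarrow> weak_le u b'"
    by (auto simp: has_greatest_def xs parab_full)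
  obtain w0 where w0: "w0 \<in> carrier G" "\<And>y. y \<in> carrier G \<Longrightarrow> len (w0 \<otimes> y) + len y = len w0"
    using longest_exists[of S] by (auto simp: parab_full)
  have "len (w0 \<otimes> w0) = 0" using w0(2)[OF w0(1)] by simp
  then have w00: "w0 \<otimes> w0 = \<one>" using len_zero w0(1) by simp
  have inv0: "inv w0 = w0" using inv_equality[OF w00 w0(1) w0(1)] .
  have w0c: "w0 \<otimes> (w0 \<otimes> y) = y" if "y \<in> carrier G" for y
    using w00 w0(1) that by (simp add: m_assoc[symmetric])
  \<comment> \<open>The preimage of \<open>b'\<close> under the order-reversing map that sends
    \<open>u\<close> to \<open>w0 u c\<close>.\<close>
  define a where "a = w0 \<otimes> (b' \<otimes> inv ?c)"
  have a: "a \<in> carrier G" using w0 b' c by (simp add: a_def)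
  have achain: "sat_chain a ts"
    using sat_chain_dual[OF w0 rts b'(1,2)] by (simp add: a_def rc)
  have least: "weak_le a u" if u: "u \<in> carrier G" "sat_chain u ts" for u
  proof -
    let ?v = "w0 \<otimes> (u \<otimes> ?c)"
    have v: "?v \<in> carrier G" using w0 u c by simp
    have "weak_le ?v b'" using b'(3)[OF v] sat_chain_dual[OF w0 ts(1) u] by blast
    then obtain y where y: "y \<in> carrier G" "b' = y \<otimes> ?v" "len b' = len y + len ?v"
      by (auto simp: weak_le_def)
    \<comment> \<open>Solving for the left factor from \<open>a\<close> to \<open>u\<close>
      conjugates the inverse of \<open>y\<close> by \<open>w0\<close>, and this conjugation
      preserves length.\<close>
    let ?g = "w0 \<otimes> (inv y \<otimes> w0)"
    have ae: "a = w0 \<otimes> (y \<otimes> (w0 \<otimes> u))"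
      unfolding a_def y(2) using w0 y(1) u c by (simp add: m_assoc)
    have "?g \<otimes> a = w0 \<otimes> (inv y \<otimes> (w0 \<otimes> (w0 \<otimes> (y \<otimes> (w0 \<otimes> u)))))"
      unfolding ae using w0 y(1) u by (simp add: m_assoc)
    also have "\<dots> = w0 \<otimes> ((inv y \<otimes> y) \<otimes> (w0 \<otimes> u))"
      using w0(1) y(1) u w0c m_assoc[of "inv y" y "w0 \<otimes> u"] by simp
    also have "\<dots> = u" using w0 y(1) u w0c by simp
    finally have ug: "u = ?g \<otimes> a" by simp
    have "len (inv y \<otimes> w0) = len (inv (inv y \<otimes> w0))" using w0 y(1) by simp
    also have "inv (inv y \<otimes> w0) = w0 \<otimes> y" using w0 y(1) inv0 by (simp add: inv_mult_group)
    finally have g: "len ?g = len y"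
      using w0(2)[of "inv y \<otimes> w0"] w0(2)[OF y(1)] w0(1) y(1) by simp
    have be: "b' = w0 \<otimes> (a \<otimes> ?c)" unfolding a_def using w0 b'(1) c w0c by (simp add: m_assoc)
    have "len b' + len (a \<otimes> ?c) = len w0" unfolding be using w0(2) a c by simp
    moreover have "len ?v + len (u \<otimes> ?c) = len w0" using w0(2) u c by simp
    moreover have "len (a \<otimes> ?c) = len a + length ts" "len (u \<otimes> ?c) = len u + length ts"
      using sat_chain_len[OF tc] a achain u by auto
    ultimately have "len u = len ?g + len a" using y(3) g by simp
    moreover have "?g \<in> carrier G" using w0 y(1) by simp
    ultimately show ?thesis unfolding weak_le_def using ug by blast
  qed
  show thesis
  proof (rule that[OF a b(1) achain])
    fix u assume u: "u \<in> carrier G"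
    show "sat_chain u ts \<longleftrightarrow> weak_le a u \<and> weak_le u b"
      using least[OF u] b(3)[OF u] sat_chain_convex[OF xsl ts a u b(1) _ _ achain b(2)] by blast
  qed
qed

section \<open>Bruhat order and absolute order\<close>

abbreviation tlen :: "'a \<Rightarrow> nat" where "tlen \<equiv> word_length G refls"

lemma simple_reflection: "s \<in> S \<Longrightarrow> s \<in> refls"
  using is_root_refls[OF is_root_simple] .

lemma tlen_attained:
  assumes "w \<in> carrier G"
  obtains ts where "ts \<in> lists refls" "wp ts = w" "length ts = tlen w"
proof -
  obtain xs where xs: "xs \<in> lists S" "wp xs = w" using word_exists[OF assms] .
  then have "xs \<in> lists refls" using simple_reflection by auto
  then show thesis using word_length_attained[of xs refls w] xs that by blast
qed

lemma tlen_mult_le: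
  assumes "u \<in> carrier G" "v \<in> carrier G" shows "tlen (u \<otimes> v) \<le> tlen u + tlen v"
proof -
  obtain xs where xs: "xs \<in> lists refls" "wp xs = u" "length xs = tlen u"
    using tlen_attained[OF assms(1)] .
  obtain ys where ys: "ys \<in> lists refls" "wp ys = v" "length ys = tlen v"
    using tlen_attained[OF assms(2)] .
  have "xs @ ys \<in> lists refls" using xs ys by auto
  moreover have "wp (xs @ ys) = u \<otimes> v" using xs ys by (simp add: word_prod_append)
  ultimately show ?thesis using word_length_le[of "xs @ ys" refls] xs ys by simp
qed

text \<open>Multiplying \<open>u\<close> by the first letter of a shortest reflection word of the
  quotient gives an element between \<open>u\<close> and \<open>v\<close> different from
  \<open>u\<close>, so it is \<open>v\<close>.\<close>

lemma absolute_cover_reflection: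
  assumes cover: "absolute_cover G S u v"
  shows "inv u \<otimes> v \<in> refls"
proof -
  have le: "absolute_le G S u v" and ne: "u \<noteq> v"
    and between: "\<And>w. absolute_le G S u w \<Longrightarrow> absolute_le G S w v \<Longrightarrow> w = u \<or> w = v"
    using cover by (auto simp: absolute_cover_def)
  have u: "u \<in> carrier G" and v: "v \<in> carrier G" and l: "tlen u + tlen (inv u \<otimes> v) = tlen v"
    using le by (auto simp: absolute_le_def)
  have uv: "u \<otimes> (inv u \<otimes> v) = v" using u v by (simp add: m_assoc[symmetric])
  obtain ts where ts: "ts \<in> lists refls" "wp ts = inv u \<otimes> v" "length ts = tlen (inv u \<otimes> v)"
    using tlen_attained[of "inv u \<otimes> v"] u v by auto
  have "ts \<noteq> []"
  proof
    assume "ts = []"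
    then have "inv u \<otimes> v = \<one>" using ts(2) by simp
    then show False using uv ne u by simp
  qed
  then obtain t rs where tr: "ts = t # rs" by (cases ts) auto
  have t: "t \<in> refls" "t \<in> carrier G" "rs \<in> lists refls" using ts(1) tr by auto
  have r: "wp rs \<in> carrier G" using t(3) by (auto intro!: word_prod_closed)
  let ?w = "u \<otimes> t"
  have w: "?w \<in> carrier G" using u t by simp
  have vw: "v = ?w \<otimes> wp rs" using uv ts(2) tr u t r by (simp add: m_assoc)
  have wv: "inv ?w \<otimes> v = wp rs" unfolding vw using w r by (simp add: m_assoc[symmetric])
  have uw: "inv u \<otimes> ?w = t" using u t by (simp add: m_assoc[symmetric])
  have "tlen t \<le> 1" using word_length_le[of "[t]" refls t] t by simp
  moreover have "tlen (wp rs) \<le> length rs" using word_length_le[OF t(3) refl] .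
  moreover have "tlen ?w \<le> tlen u + tlen t" using tlen_mult_le[OF u t(2)] .
  moreover have "tlen v \<le> tlen ?w + tlen (wp rs)" unfolding vw using tlen_mult_le[OF w r] .
  \<comment> \<open>The total is exactly \<open>tlen v\<close>, so every subadditivity estimate must
    be an equality.\<close>
  ultimately have "absolute_le G S u ?w" "absolute_le G S ?w v" "tlen t = 1"
    using l ts(3) tr u v w wv uw by (simp_all add: absolute_le_def)
  moreover have "?w \<noteq> u"
  proof
    assume "?w = u"
    then have "t = \<one>" using u t by simp
    with \<open>tlen t = 1\<close> show False by simp
  qed
  ultimately have "?w = v" using between by blast
  then show ?thesis using uw t by simp
qed

lemma bruhat_le_len:
  assumes "bruhat_le G S u v" shows "u = v \<or> len u < len v"
proof -
  have "(bruhat_cover G S)\<^sup>*\<^sup>* u v" using assms by (simp add: bruhat_le_def)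
  then show ?thesis by (induction rule: rtranclp_induct) (auto simp: bruhat_cover_def)
qed

lemma max_chain_factors:
  assumes "\<pi> \<in> max_chains G S c"
  obtains ts where "ts \<in> lists refls" "length ts = card S" "wp ts = c"
    "\<And>i. i \<le> card S \<Longrightarrow> \<pi> ! i = wp (take i ts)"
proof -
  let ?r = "card S"
  have p: "\<pi> ! 0 = \<one>" "\<pi> ! ?r = c" "\<And>i. i < ?r \<Longrightarrow> absolute_cover G S (\<pi> ! i) (\<pi> ! Suc i)"
    using assms by (auto simp: max_chains_def)
  define ts where "ts = map (\<lambda>i. inv (\<pi> ! i) \<otimes> \<pi> ! Suc i) [0..<?r]"
  have pc: "\<pi> ! i \<in> carrier G" if "i \<le> ?r" for i
    using that p(1) p(3)[of "i - 1"] by (cases i) (auto simp: absolute_cover_def absolute_le_def)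
  have nth: "ts ! i = inv (\<pi> ! i) \<otimes> \<pi> ! Suc i" if "i < ?r" for i using that by (simp add: ts_def)
  have len_ts: "length ts = ?r" by (simp add: ts_def)
  have refl: "ts \<in> lists refls"
    using absolute_cover_reflection[OF p(3)] by (auto simp: ts_def)
  then have tc: "set ts \<subseteq> carrier G" by simp
  have pre: "\<pi> ! i = wp (take i ts)" if "i \<le> ?r" for i
    using that
  proof (induction i)
    case 0
    then show ?case using p by simp
  next
    case (Suc i)
    then have i: "i < ?r" "i < length ts" using len_ts by auto
    have "set (take i ts) \<subseteq> carrier G" "ts ! i \<in> carrier G"
      using tc set_take_subset[of i ts] nth_mem[OF i(2)] by auto
    then have "wp (take (Suc i) ts) = \<pi> ! i \<otimes> ts ! i"
      using i Suc by (simp add: take_Suc_conv_app_nth word_prod_append)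
    also have "\<dots> = \<pi> ! Suc i" unfolding nth[OF i(1)]
      using pc[of i] pc[of "Suc i"] i by (simp add: m_assoc[symmetric])
    finally show ?case by simp
  qed
  show thesis using that[OF refl len_ts _ pre] pre[of ?r] p(2) len_ts by simp
qed

text \<open>Consecutive elements of the chain differ, so each Bruhat relation raises the length;
  \<open>W_plus\<close> fixes the total rise at \<open>card S\<close>, which leaves exactly one per
  step. Conversely, a rise of one by a reflection is a Bruhat cover.\<close>

lemma concordant_iff_sat_chain:
  assumes \<pi>: "\<pi> \<in> max_chains G S c" and ts: "ts \<in> lists refls" "length ts = card S" "wp ts = c"
    "\<And>i. i \<le> card S \<Longrightarrow> \<pi> ! i = wp (take i ts)" and u: "u \<in> carrier G"
  shows "u \<in> W_plus G S c \<and> concordant G S u \<pi> \<longleftrightarrow> sat_chain u ts"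
proof -
  have tc: "set ts \<subseteq> carrier G" using ts by simp
  have cover: "absolute_cover G S (\<pi> ! i) (\<pi> ! Suc i)" if "i < card S" for i
    using \<pi> that by (simp add: max_chains_def)
  have pc: "\<pi> ! i \<in> carrier G" if "i \<le> card S" for i
    unfolding ts(4)[OF that] using tc set_take_subset[of i ts] by (intro word_prod_closed) auto
  have iff: "sat_chain u ts \<longleftrightarrow> (\<forall>i<card S. len (u \<otimes> \<pi> ! Suc i) = len (u \<otimes> \<pi> ! i) + 1)"
    unfolding sat_chain_iff[OF tc u] ts(2) using ts(4) by simp
  show ?thesis
  proof
    assume *: "u \<in> W_plus G S c \<and> concordant G S u \<pi>"
    let ?f = "\<lambda>i. len (u \<otimes> \<pi> ! i)"
    have "?f i < ?f (Suc i)" if i: "i < card S" for i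
    proof -
      have "u \<otimes> \<pi> ! i \<noteq> u \<otimes> \<pi> ! Suc i"
        using cover[OF i] pc[of i] pc[of "Suc i"] i u by (auto simp: absolute_cover_def)
      then show ?thesis using bruhat_le_len * i unfolding concordant_def by blast
    qed
    moreover have "?f (card S) \<le> ?f 0 + card S"
      using * \<pi> u by (simp add: W_plus_def max_chains_def)
    ultimately show "sat_chain u ts" unfolding iff using increasing_sequence_tight[of "card S" ?f] by blast
  next
    assume *: "sat_chain u ts"
    have "u \<in> W_plus G S c" using sat_chain_len[OF tc u *] ts u by (simp add: W_plus_def)
    moreover have "concordant G S u \<pi>" unfolding concordant_def
    proof (intro allI impI)
      fix i assume i: "i < card S"
      have c: "\<pi> ! i \<in> carrier G" "\<pi> ! Suc i \<in> carrier G" using pc i by auto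
      let ?t = "inv (\<pi> ! i) \<otimes> \<pi> ! Suc i"
      have "\<pi> ! i \<otimes> ?t = \<pi> ! Suc i" using c by (simp add: m_assoc[symmetric])
      then have "u \<otimes> \<pi> ! Suc i = u \<otimes> \<pi> ! i \<otimes> ?t" using c u by (simp add: m_assoc)
      then have "bruhat_cover G S (u \<otimes> \<pi> ! i) (u \<otimes> \<pi> ! Suc i)"
        unfolding bruhat_cover_def using absolute_cover_reflection[OF cover[OF i]] * i c u iff by auto
      then show "bruhat_le G S (u \<otimes> \<pi> ! i) (u \<otimes> \<pi> ! Suc i)" unfolding bruhat_le_def using c u by auto
    qed
    ultimately show "u \<in> W_plus G S c \<and> concordant G S u \<pi>" ..
  qed
qed


end

theorem theorem5p10:
  fixes G :: "('a, 'b) monoid_scheme" and S :: "'a set" and c :: 'a and \<pi> :: "'a list"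
  assumes "coxeter_system G S"
    and "finite (carrier G)"
    and "standard_coxeter_element G S c"
    and "\<pi> \<in> max_chains G S c"
  shows "\<exists>\<omega>\<^sub>d \<in> carrier G. \<exists>\<omega>\<^sub>u \<in> carrier G.
           {u \<in> W_plus G S c. concordant G S u \<pi>} = left_weak_interval G S \<omega>\<^sub>d \<omega>\<^sub>u \<and>
           left_weak_interval G S \<omega>\<^sub>d \<omega>\<^sub>u \<noteq> {}"
proof -
  interpret coxeter_system G S by fact
  interpret finite_coxeter_system G S by unfold_locales fact
  obtain xs where xs: "distinct xs" "set xs = S" "wp xs = c"
    using assms(3) by (auto simp: standard_coxeter_element_def)
  obtain ts where ts: "ts \<in> lists refls" "length ts = card S" "wp ts = c"
    "\<And>i. i \<le> card S \<Longrightarrow> \<pi> ! i = wp (take i ts)"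
    using max_chain_factors[OF assms(4)] by blast
  have l: "length ts = length xs" using ts(2) distinct_card[OF xs(1)] xs(2) by simp
  have e: "wp ts = wp xs" using ts(3) xs(3) by simp
  obtain a b where ab: "a \<in> carrier G" "b \<in> carrier G" "sat_chain a ts"
    "\<And>u. u \<in> carrier G \<Longrightarrow> sat_chain u ts \<longleftrightarrow> weak_le a u \<and> weak_le u b"
    using concordance_interval[OF xs(1,2) ts(1) l e] by blast
  have "u \<in> W_plus G S c \<and> concordant G S u \<pi> \<longleftrightarrow> u \<in> left_weak_interval G S a b" for u
  proof (cases "u \<in> carrier G")
    case True
    then show ?thesis
      using concordant_iff_sat_chain[OF assms(4) ts True] ab(4)[OF True] left_weak_le_iff ab(1)
      by (simp add: left_weak_interval_def)
  next
    case False
    then show ?thesis by (simp add: W_plus_def left_weak_interval_def)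
  qed
  then have eq: "{u \<in> W_plus G S c. concordant G S u \<pi>} = left_weak_interval G S a b" by blast
  moreover have "a \<in> left_weak_interval G S a b"
    using concordant_iff_sat_chain[OF assms(4) ts ab(1)] ab(3) eq by blast
  ultimately show ?thesis using ab(1,2) by blast
qed

end
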